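(* Let $Q$ be a connected finite acyclic quiver with vertices $1,\dots,n$ labelled as in the context, and let $b_\ast\in\mathbb{C}^n$ be any generic specialization. Then for generic $a_\ast\in X(Q,b_\ast)$ we have $X(Q,a_\ast)=X(Q,b_\ast)$. That is: for each irreducible component $X_i$ of $X(Q,b_\ast)$ there are dense Zariski-open subsets $U_i^d\subset X_i$ ($d=1,2,3,\dots$) such that, putting $U_i^\infty=\bigcap_{d\ge1}U_i^d$, every $a_\ast\in\bigcup_i U_i^\infty$ is a generic specialization and satisfies $X(Q,a_\ast)=X(Q,b_\ast)$.
   Context: $Q$ is a connected finite quiver without oriented cycles (multiple arrows allowed), with vertices labelled $1,\dots,n$ so that if there is an arrow $i\to j$ then $i>j$. Coxeter mutation: for $a_\ast=(a_1,\dots,a_n)\in(\mathbb{C}^\times)^n$ put $\mu_\ast(a_\ast)=(a_1',\dots,a_n')\in\mathbb{C}^n$, where recursively for $k=1,\dots,n$ $$a_k'=\frac{1+\prod_{j\to k}a_j\prod_{k\to j}a_j'}{a_k},$$ the products running over all arrows of $Q$ ending at $k$, respectively starting at $k$, counted with multiplicity. (This is the specialization at $x_i=a_i$ of the cluster obtained from the initial cluster $\mathbf{x}=(x_1,\dots,x_n)$ of the cluster algebra of $Q$ by the mutation sequence $\mu_n\circ\cdots\circ\mu_2\circ\mu_1$.) $\mu_\ast^t$ denotes the $t$-fold iterate. A point $a_\ast\in\mathbb{C}^n$ is a generic specialization (of $\mathbf{x}$) if all coordinates of $\mu_\ast^t(a_\ast)$ are nonzero for all $t\ge 0$. The $\mu_\ast$-orbit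 of $a_\ast$ is $\{\mu_\ast^t(a_\ast):t\ge 0\}$. For a generic specialization $a_\ast$, the generalized frieze variety $X(Q,a_\ast)$ is the Zariski closure in $\mathbb{C}^n$ of the $\mu_\ast$-orbit of $a_\ast$. *)

theory Defs
  imports "HOL-Analysis.Analysis" "Graph_Theory.Digraph_Component"
begin

section \<open>The Zariski topology on affine space\<close>

text \<open>Complex counterpart of \<^const>\<open>real_polynomial_function\<close>: the elements of
  \<open>\<complex>[x\<^sub>1,\<dots>,x\<^sub>n]\<close>, identified with the functions that they induce.\<close>

inductive complex_polynomial_function :: "(complex ^ 'n \<Rightarrow> complex) \<Rightarrow> bool" where
  coord: "complex_polynomial_function (\<lambda>x. x $ i)"
| const: "complex_polynomial_function (\<lambda>x. c)"
| add: "\<lbrakk>complex_polynomial_function f; complex_polynomial_function g\<rbrakk>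
    \<Longrightarrow> complex_polynomial_function (\<lambda>x. f x + g x)"
| mult: "\<lbrakk>complex_polynomial_function f; complex_polynomial_function g\<rbrakk>
    \<Longrightarrow> complex_polynomial_function (\<lambda>x. f x * g x)"

definition zero_locus :: "(complex ^ 'n \<Rightarrow> complex) set \<Rightarrow> (complex ^ 'n) set" where
  "zero_locus P = {x. \<forall>p\<in>P. p x = 0}"

definition algebraic_set :: "(complex ^ 'n) set \<Rightarrow> bool" where
  "algebraic_set Z \<longleftrightarrow> (\<exists>P. (\<forall>p\<in>P. complex_polynomial_function p) \<and> Z = zero_locus P)"

definition zariski :: "(complex ^ 'n) topology" where
  "zariski = topology (\<lambda>U. algebraic_set (- U))"

lemma algebraic_set_Un:
  assumes "algebraic_set A" "algebraic_set B"
  shows "algebraic_set (A \<union> B)"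
proof -
  obtain P Q where P: "\<forall>p\<in>P. complex_polynomial_function p" "A = zero_locus P"
    and Q: "\<forall>q\<in>Q. complex_polynomial_function q" "B = zero_locus Q"
    using assms unfolding algebraic_set_def by blast
  let ?R = "{\<lambda>x. p x * q x | p q. p \<in> P \<and> q \<in> Q}"
  have "\<forall>r\<in>?R. complex_polynomial_function r"
    using P(1) Q(1) by (auto intro: complex_polynomial_function.mult)
  moreover have "A \<union> B = zero_locus ?R"
  proof (intro set_eqI iffI)
    fix x assume "x \<in> A \<union> B"
    then show "x \<in> zero_locus ?R"
      unfolding P(2) Q(2) zero_locus_def by auto
  next
    fix x assume x: "x \<in> zero_locus ?R"
    have "p x * q x = 0" if "p \<in> P" "q \<in> Q" for p q
    proof -
      have "(\<lambda>x. p x * q x) \<in> ?R"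
        using that by blast
      then show ?thesis
        using x unfolding zero_locus_def by fastforce
    qed
    then show "x \<in> A \<union> B"
      unfolding P(2) Q(2) zero_locus_def by (auto simp only: Un_iff mem_Collect_eq mult_eq_0_iff)
  qed
  ultimately show ?thesis
    unfolding algebraic_set_def by blast
qed

lemma algebraic_set_INT:
  assumes "\<And>U. U \<in> K \<Longrightarrow> algebraic_set (A U)"
  shows "algebraic_set (\<Inter>U\<in>K. A U)"
proof -
  have "\<forall>U\<in>K. \<exists>P. (\<forall>p\<in>P. complex_polynomial_function p) \<and> A U = zero_locus P"
    using assms unfolding algebraic_set_def by blast
  then obtain P where P: "\<forall>U\<in>K. (\<forall>p\<in>P U. complex_polynomial_function p) \<and> A U = zero_locus (P U)"
    by metis
  have "(\<Inter>U\<in>K. A U) = zero_locus (\<Union>U\<in>K. P U)"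
    using P by (auto simp: zero_locus_def)
  moreover have "\<forall>p\<in>(\<Union>U\<in>K. P U). complex_polynomial_function p"
    using P by blast
  ultimately show ?thesis
    unfolding algebraic_set_def by blast
qed

lemma istopology_zariski: "istopology (\<lambda>U. algebraic_set (- U))"
  unfolding istopology_def
  by (auto simp: Compl_Int uminus_Sup intro: algebraic_set_Un algebraic_set_INT)

lemma openin_zariski: "openin zariski U \<longleftrightarrow> algebraic_set (- U)"
  by (simp add: zariski_def istopology_zariski topology_inverse')

lemma topspace_zariski [simp]: "topspace zariski = UNIV"
proof -
  have "algebraic_set {}"
    unfolding algebraic_set_def
    by (rule exI[of _ "{\<lambda>x. 1}"]) (auto simp: zero_locus_def complex_polynomial_function.const)
  then show ?thesis
    using openin_subset[of zariski UNIV] by (simp add: openin_zariski top.extremum_unique)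
qed

lemma closedin_zariski: "closedin zariski Z \<longleftrightarrow> algebraic_set Z"
  by (simp add: closedin_def openin_zariski Compl_eq_Diff_UNIV [symmetric])

definition irreducible_in :: "'a topology \<Rightarrow> 'a set \<Rightarrow> bool" where
  "irreducible_in T S \<longleftrightarrow> S \<subseteq> topspace T \<and> S \<noteq> {} \<and>
     (\<forall>A B. closedin T A \<and> closedin T B \<and> S \<subseteq> A \<union> B \<longrightarrow> S \<subseteq> A \<or> S \<subseteq> B)"

definition irreducible_components :: "'a topology \<Rightarrow> 'a set \<Rightarrow> 'a set set" where
  "irreducible_components T X =
     {S. S \<subseteq> X \<and> irreducible_in T S \<and>
         (\<forall>S'. S \<subseteq> S' \<and> S' \<subseteq> X \<and> irreducible_in T S' \<longrightarrow> S' = S)}"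

definition dense_open_in :: "'a topology \<Rightarrow> 'a set \<Rightarrow> 'a set \<Rightarrow> bool" where
  "dense_open_in T Y U \<longleftrightarrow> openin (subtopology T Y) U \<and> subtopology T Y closure_of U = Y"


section \<open>Coxeter mutation and generalized frieze varieties\<close>

text \<open>A quiver is a finite directed multigraph; the arrow \<open>e\<close> runs from \<open>tail Q e\<close> to
  \<open>head Q e\<close>. The labels \<open>1 < \<dots> < n\<close> are the elements of a finite linearly ordered type
  \<open>'n\<close>, so that \<open>n = CARD('n)\<close> and \<open>\<complex>\<^sup>n\<close> is \<open>complex ^ 'n\<close>. The condition \<open>arrow_decreasing\<close>
  on the labels rules out oriented cycles (including loops). The type is written
  \<open>(complex, 'n) vec\<close> below because the notation \<open>complex ^ 'n\<close> would add the clashing sort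
  constraint \<open>finite\<close> to \<open>'n\<close>.\<close>

locale labelled_acyclic_quiver = fin_digraph Q
  for Q :: "('n :: {finite, linorder}, 'e) pre_digraph" +
  assumes verts_UNIV: "verts Q = UNIV"
    and connected_quiver: "Digraph_Component.connected Q"
    and arrow_decreasing: "e \<in> arcs Q \<Longrightarrow> head Q e < tail Q e"
begin

text \<open>\<open>mutated_coord a k\<close> is \<open>a\<^sub>k'\<close>.  As \<open>x / 0 = 0\<close>, it is defined for all \<open>a\<close>, but is
  meaningful only if all coordinates of \<open>a\<close> are nonzero.\<close>

function mutated_coord :: "(complex, 'n) vec \<Rightarrow> 'n \<Rightarrow> complex" where
  "mutated_coord a k =
     (1 + (\<Prod>e | e \<in> arcs Q \<and> head Q e = k. a $ tail Q e) *
          (\<Prod>e | e \<in> arcs Q \<and> tail Q e = k. mutated_coord a (head Q e))) / a $ k"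
  by pat_completeness auto
termination
proof (relation "Wellfounded.measure (\<lambda>(a, k). card {..<k})")
  fix a :: "(complex, 'n) vec" and k :: 'n and e
  assume "e \<in> {e. e \<in> arcs Q \<and> tail Q e = k}"
  then have "head Q e < k"
    using arrow_decreasing by blast
  then have "{..<head Q e} \<subset> {..<k}"
    by (auto intro: less_trans)
  then show "((a, head Q e), (a, k)) \<in> Wellfounded.measure (\<lambda>(a, k). card {..<k})"
    by (simp add: psubset_card_mono)
qed simp

declare mutated_coord.simps [simp del]

definition coxeter_mutation :: "(complex, 'n) vec \<Rightarrow> (complex, 'n) vec" where
  "coxeter_mutation a = (\<chi> k. mutated_coord a k)"

text \<open>If a coordinate vanishes at some stage, then the point is not generic whatever the later
  iterates are, so the values of \<open>coxeter_mutation\<close> outside \<open>(\<complex>\<^sup>\<times>)\<^sup>n\<close> are irrelevant here.\<close>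

definition generic_specialization :: "(complex, 'n) vec \<Rightarrow> bool" where
  "generic_specialization a \<longleftrightarrow> (\<forall>t k. (coxeter_mutation ^^ t) a $ k \<noteq> 0)"

definition coxeter_orbit :: "(complex, 'n) vec \<Rightarrow> ((complex, 'n) vec) set" where
  "coxeter_orbit a = {(coxeter_mutation ^^ t) a | t. True}"

definition frieze_variety :: "(complex, 'n) vec \<Rightarrow> ((complex, 'n) vec) set" where
  "frieze_variety a = zariski closure_of coxeter_orbit a"

end

end

theory Submission
  imports Defs "HOL-Library.Function_Algebras"
begin

text \<open>Write \<open>\<mu>\<close> for the Coxeter mutation, \<open>b\<^sub>t = \<mu>\<^sup>t(b)\<close> and \<open>X = X(Q,b)\<close>.

  The variety does not change along the orbit: \<open>X(Q,b\<^sub>t) = X\<close> for all \<open>t\<close>.  The varieties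
  \<open>X(Q,b\<^sub>t)\<close> decrease, so \<open>X(Q,b\<^sub>t\<^sub>+\<^sub>1) = X(Q,b\<^sub>t)\<close> for some \<open>t\<close> because the Zariski topology is
  Noetherian; thus \<open>b\<^sub>t\<close> is in the closure of the orbit of \<open>b\<^sub>t\<^sub>+\<^sub>1\<close>.  Now \<open>\<mu>\<close> is birational: both
  \<open>\<mu>\<close> and its inverse are given by fractions of polynomials whose denominators do not vanish on the
  torus, where the whole orbit lives.  Applying the inverse \<open>t\<close> times gives
  \<open>b \<in> X(Q,b\<^sub>1)\<close> (\<open>generic_point_recurs\<close>), and this holds for every generic point, in particular for each
  \<open>b\<^sub>t\<close>.  Similarly \<open>X(Q,a) \<subseteq> X\<close> for every generic \<open>a \<in> X\<close> (\<open>frieze_variety_subset\<close>), so what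
  remains is \<open>X \<subseteq> X(Q,a)\<close>: a polynomial vanishing on the orbit of \<open>a\<close> must vanish on \<open>X\<close>.

  Enumerate the monomials, and for each \<open>d\<close> select among the first \<open>d\<close> of them a basis \<open>B\<^sub>d\<close> of
  their span modulo the ideal of \<open>X\<close>.  The inclusion \<open>X \<subseteq> X(Q,a)\<close> follows if for every \<open>d\<close> the
  functions in \<open>B\<^sub>d\<close> are linearly independent on the orbit of \<open>a\<close>
  (\<open>frieze_variety_eq_of_independent\<close>).  For fixed \<open>d\<close> this independence, together with
  genericity up to time \<open>d\<close>, follows from an open condition: independence along the orbit is witnessed at finitely many times
  by a nonvanishing determinant, which is a fraction of polynomials in \<open>a\<close> (\<open>independence_open\<close>).
  The condition holds at a point of each component \<open>Y\<close>: since \<open>Y\<close> is one of finitely many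
  components, it contains some \<open>b\<^sub>t\<close>, and \<open>B\<^sub>d\<close> is independent on the orbit of \<open>b\<^sub>t\<close>, whose closure
  is again \<open>X\<close>.  A nonempty open subset of an irreducible set is dense, so these conditions define the
  sets \<open>U Y d\<close> (\<open>dense_open_independent\<close>).

  That the Zariski topology is Noetherian is Hilbert's basis theorem, which is proved below for
  subrings of a commutative ring and applied inside the ring of functions on affine space, by adjoining
  one coordinate function after the other to the constants.\<close>

section \<open>Hilbert's basis theorem\<close>

text \<open>Rings and ideals are subsets of a type of class \<^class>\<open>comm_ring_1\<close>, rather than types, because the
induction over the variables passes through a chain of different subrings of one function ring.\<close>

definition subring_set :: "'r::comm_ring_1 set \<Rightarrow> bool" where
  "subring_set R \<longleftrightarrow> 1 \<in> R \<and> (\<forall>x\<in>R. \<forall>y\<in>R. x - y \<in> R \<and> x * y \<in> R)"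

inductive_set ideal_span :: "'r::comm_ring_1 set \<Rightarrow> 'r set \<Rightarrow> 'r set" for R S where
  zero: "0 \<in> ideal_span R S"
| step: "\<lbrakk>r \<in> R; s \<in> S; y \<in> ideal_span R S\<rbrakk> \<Longrightarrow> r * s + y \<in> ideal_span R S"

text \<open>Finite generation is demanded for the ideal generated by an arbitrary set, with generators taken from
that set.  This is the form in which the property is applied to sequences.\<close>

definition noetherian_set :: "'r::comm_ring_1 set \<Rightarrow> bool" where
  "noetherian_set R \<longleftrightarrow> (\<forall>S\<subseteq>R. \<exists>T\<subseteq>S. finite T \<and> S \<subseteq> ideal_span R T)"

lemma subring_set_closed:
  assumes "subring_set R"
  shows "0 \<in> R" "1 \<in> R"
    and "\<And>x y. x \<in> R \<Longrightarrow> y \<in> R \<Longrightarrow> x - y \<in> R"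
    and "\<And>x y. x \<in> R \<Longrightarrow> y \<in> R \<Longrightarrow> x * y \<in> R"
    and "\<And>x. x \<in> R \<Longrightarrow> - x \<in> R"
    and "\<And>x y. x \<in> R \<Longrightarrow> y \<in> R \<Longrightarrow> x + y \<in> R"
proof -
  show one: "1 \<in> R" and diff: "\<And>x y. x \<in> R \<Longrightarrow> y \<in> R \<Longrightarrow> x - y \<in> R"
    and "\<And>x y. x \<in> R \<Longrightarrow> y \<in> R \<Longrightarrow> x * y \<in> R"
    using assms by (auto simp: subring_set_def)
  show zero: "0 \<in> R"
    using diff[OF one one] by simp
  show minus: "- x \<in> R" if "x \<in> R" for x
    using diff[OF zero that] by simp
  show "x + y \<in> R" if "x \<in> R" "y \<in> R" for x y
    using diff[OF that(1) minus[OF that(2)]] by simp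
qed

lemma ideal_span_add:
  "y \<in> ideal_span R S \<Longrightarrow> z \<in> ideal_span R S \<Longrightarrow> y + z \<in> ideal_span R S"
  by (induction rule: ideal_span.induct) (auto simp: add.assoc intro: ideal_span.step)

lemma ideal_span_mult:
  assumes "subring_set R" "r \<in> R" "y \<in> ideal_span R S"
  shows "r * y \<in> ideal_span R S"
  using assms(3)
proof (induction rule: ideal_span.induct)
  case zero
  then show ?case
    by (simp add: ideal_span.zero)
next
  case (step a s y)
  then have "(r * a) * s + r * y \<in> ideal_span R S"
    using assms(1,2) by (intro ideal_span.step) (auto intro: subring_set_closed)
  then show ?case
    by (simp add: algebra_simps)
qed

lemma ideal_span_diff:
  assumes "subring_set R" "y \<in> ideal_span R S" "z \<in> ideal_span R S"
  shows "y - z \<in> ideal_span R S"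
proof -
  have "(- 1) * z \<in> ideal_span R S"
    using assms by (intro ideal_span_mult subring_set_closed) auto
  then show ?thesis
    using ideal_span_add[OF assms(2)] by fastforce
qed

lemma ideal_span_base:
  assumes "subring_set R" "s \<in> S"
  shows "s \<in> ideal_span R S"
  using ideal_span.step[OF subring_set_closed(2)[OF assms(1)] assms(2) ideal_span.zero] by simp

lemma ideal_span_mono:
  assumes "S \<subseteq> T"
  shows "ideal_span R S \<subseteq> ideal_span R T"
proof
  fix y assume "y \<in> ideal_span R S"
  then show "y \<in> ideal_span R T"
    using assms by induction (auto intro: ideal_span.intros)
qed

lemma ideal_span_least:
  assumes "subring_set R" "S \<subseteq> ideal_span R T"
  shows "ideal_span R S \<subseteq> ideal_span R T"
proof
  fix y assume "y \<in> ideal_span R S"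
  then show "y \<in> ideal_span R T"
    using assms by induction (auto intro: ideal_span.zero ideal_span_add ideal_span_mult)
qed

lemma ideal_span_subset_ring:
  assumes "subring_set R" "S \<subseteq> R"
  shows "ideal_span R S \<subseteq> R"
proof
  fix y assume "y \<in> ideal_span R S"
  then show "y \<in> R"
    using assms by induction (auto intro: subring_set_closed)
qed

lemma ideal_span_finite_support:
  assumes "finite T" "T \<subseteq> ideal_span R S"
  obtains T' where "finite T'" "T' \<subseteq> S" "T \<subseteq> ideal_span R T'"
proof -
  have elem: "\<exists>T'. finite T' \<and> T' \<subseteq> S \<and> y \<in> ideal_span R T'" if "y \<in> ideal_span R S" for y
    using that
  proof induction
    case zero
    then show ?case
      by (intro exI[of _ "{}"]) (auto intro: ideal_span.zero)
  next
    case (step r s y)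
    then obtain T' where T': "finite T'" "T' \<subseteq> S" "y \<in> ideal_span R T'"
      by blast
    then have "y \<in> ideal_span R (insert s T')"
      using ideal_span_mono[of T' "insert s T'"] by blast
    with T' step.hyps show ?case
      by (intro exI[of _ "insert s T'"]) (auto intro: ideal_span.step)
  qed
  have "\<exists>T'. finite T' \<and> T' \<subseteq> S \<and> T \<subseteq> ideal_span R T'"
    using assms
  proof (induction T rule: finite_induct)
    case empty
    then show ?case
      by blast
  next
    case (insert y T)
    then obtain T1 T2 where "finite T1" "T1 \<subseteq> S" "T \<subseteq> ideal_span R T1"
      and "finite T2" "T2 \<subseteq> S" "y \<in> ideal_span R T2"
      using elem[of y] by blast
    then show ?case
      using ideal_span_mono[of T1 "T1 \<union> T2" R] ideal_span_mono[of T2 "T1 \<union> T2" R]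
      by (intro exI[of _ "T1 \<union> T2"]) blast
  qed
  then show thesis
    using that by blast
qed

text \<open>Finitely many generators of the ideal of all \<open>f i\<close> involve only finitely many indices; any later member
of the sequence is generated by its predecessors.\<close>

lemma noetherian_set_sequence:
  assumes "noetherian_set R" "range f \<subseteq> R"
  obtains m :: nat where "f m \<in> ideal_span R (f ` {..<m})"
proof -
  obtain T where T: "T \<subseteq> range f" "finite T" "range f \<subseteq> ideal_span R T"
    using assms(1)[unfolded noetherian_set_def, rule_format, OF assms(2)] by metis
  obtain N where N: "finite N" "T = f ` N"
    using finite_subset_image[OF T(2,1)] by blast
  then have "N \<subseteq> {..<Suc (Max (insert 0 N))}"
    by (auto simp: less_Suc_eq_le)
  then have "T \<subseteq> f ` {..<Suc (Max (insert 0 N))}"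
    unfolding N(2) by (rule image_mono)
  then have "range f \<subseteq> ideal_span R (f ` {..<Suc (Max (insert 0 N))})"
    by (rule order_trans[OF T(3) ideal_span_mono])
  then show thesis
    by (intro that) (rule subsetD[OF _ rangeI])
qed

text \<open>These are elements of the ambient ring, not formal polynomials: \<open>x\<close> may satisfy relations over \<open>R\<close>, so
\<open>n\<close> bounds the degree of some representation and is not determined by the element.\<close>

primrec polys_below :: "'r::comm_ring_1 set \<Rightarrow> 'r \<Rightarrow> nat \<Rightarrow> 'r set" where
  "polys_below R x 0 = {0}"
| "polys_below R x (Suc n) = {c * x ^ n + p | c p. c \<in> R \<and> p \<in> polys_below R x n}"

definition adjoin :: "'r::comm_ring_1 set \<Rightarrow> 'r \<Rightarrow> 'r set" where
  "adjoin R x = (\<Union>n. polys_below R x n)"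

context
  fixes R :: "'r::comm_ring_1 set" and x :: 'r
  assumes R: "subring_set R"
begin

lemma polys_below_SucI:
  "c \<in> R \<Longrightarrow> p \<in> polys_below R x n \<Longrightarrow> c * x ^ n + p \<in> polys_below R x (Suc n)"
  by auto

lemma polys_below_zero: "0 \<in> polys_below R x n"
proof (induction n)
  case (Suc n)
  then show ?case
    using polys_below_SucI[OF subring_set_closed(1)[OF R], of 0 n] by simp
qed simp

lemma polys_below_mono:
  assumes "m \<le> n"
  shows "polys_below R x m \<subseteq> polys_below R x n"
  using assms
proof (induction rule: dec_induct)
  case (step n)
  have "polys_below R x n \<subseteq> polys_below R x (Suc n)"
    using polys_below_SucI[OF subring_set_closed(1)[OF R], of _ n] by auto
  then show ?case
    using step.IH by blast
qed simp

lemma polys_below_diff: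
  "\<lbrakk>p \<in> polys_below R x n; q \<in> polys_below R x n\<rbrakk> \<Longrightarrow> p - q \<in> polys_below R x n"
proof (induction n arbitrary: p q)
  case (Suc n)
  then obtain c p' d q' where "p = c * x ^ n + p'" "q = d * x ^ n + q'" "c \<in> R" "d \<in> R"
    "p' \<in> polys_below R x n" "q' \<in> polys_below R x n"
    by auto
  moreover from this have "(c - d) * x ^ n + (p' - q') \<in> polys_below R x (Suc n)"
    by (intro polys_below_SucI Suc.IH subring_set_closed[OF R])
  ultimately show ?case
    by (simp only: algebra_simps)
qed simp

lemma polys_below_scale:
  "\<lbrakk>r \<in> R; p \<in> polys_below R x n\<rbrakk> \<Longrightarrow> r * p \<in> polys_below R x n"
proof (induction n arbitrary: p)
  case (Suc n)
  then obtain c p' where "p = c * x ^ n + p'" "c \<in> R" "p' \<in> polys_below R x n"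
    by auto
  moreover from this have "(r * c) * x ^ n + r * p' \<in> polys_below R x (Suc n)"
    using Suc.prems(1) by (intro polys_below_SucI Suc.IH subring_set_closed[OF R])
  ultimately show ?case
    by (simp only: algebra_simps)
qed simp

lemma polys_below_power:
  "p \<in> polys_below R x n \<Longrightarrow> x ^ m * p \<in> polys_below R x (m + n)"
proof (induction n arbitrary: p)
  case 0
  then show ?case
    using polys_below_zero by simp
next
  case (Suc n)
  then obtain c p' where "p = c * x ^ n + p'" "c \<in> R" "p' \<in> polys_below R x n"
    by auto
  moreover from this have "c * x ^ (m + n) + x ^ m * p' \<in> polys_below R x (Suc (m + n))"
    by (intro polys_below_SucI Suc.IH)
  ultimately show ?case
    by (simp only: algebra_simps power_add add_Suc_right)
qed

lemma subring_adjoin: "subring_set (adjoin R x)"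
proof -
  have one: "1 \<in> polys_below R x 1"
    using subring_set_closed(2)[OF R] by auto
  have diff: "p - q \<in> adjoin R x" if "p \<in> adjoin R x" "q \<in> adjoin R x" for p q
  proof -
    obtain m n where "p \<in> polys_below R x m" "q \<in> polys_below R x n"
      using \<open>p \<in> adjoin R x\<close> \<open>q \<in> adjoin R x\<close> unfolding adjoin_def by blast
    then have "p \<in> polys_below R x (max m n)" "q \<in> polys_below R x (max m n)"
      using polys_below_mono[of m "max m n"] polys_below_mono[of n "max m n"] by auto
    then show ?thesis
      unfolding adjoin_def using polys_below_diff by blast
  qed
  have zero: "0 \<in> adjoin R x"
    unfolding adjoin_def using polys_below_zero by blast
  have add: "p + q \<in> adjoin R x" if "p \<in> adjoin R x" "q \<in> adjoin R x" for p q
    using diff[OF that(1) diff[OF zero that(2)]] by simp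
  have mult: "p * q \<in> adjoin R x" if p: "p \<in> polys_below R x m" and q: "q \<in> adjoin R x" for p q m
    using p
  proof (induction m arbitrary: p)
    case 0
    then show ?case
      using zero by simp
  next
    case (Suc m)
    then obtain c p' where p: "p = c * x ^ m + p'" "c \<in> R" "p' \<in> polys_below R x m"
      by auto
    obtain n where "q \<in> polys_below R x n"
      using q unfolding adjoin_def by blast
    then have "c * (x ^ m * q) \<in> adjoin R x"
      unfolding adjoin_def using polys_below_scale[OF p(2) polys_below_power] by blast
    then have "c * (x ^ m * q) + p' * q \<in> adjoin R x"
      by (rule add[OF _ Suc.IH[OF p(3)]])
    then show ?case
      using p(1) by (simp add: algebra_simps)
  qed
  have "1 \<in> adjoin R x"
    unfolding adjoin_def using one by blast
  moreover have "p * q \<in> adjoin R x" if "p \<in> adjoin R x" "q \<in> adjoin R x" for p q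
    using mult that unfolding adjoin_def[of R x] by blast
  ultimately show ?thesis
    unfolding subring_set_def using diff by blast
qed

lemma adjoin_base: "R \<subseteq> adjoin R x" "x \<in> adjoin R x"
proof -
  have "r * x ^ 0 + 0 \<in> polys_below R x (Suc 0)" if "r \<in> R" for r
    using that unfolding polys_below.simps by blast
  then have "R \<subseteq> polys_below R x (Suc 0)"
    by auto
  then show "R \<subseteq> adjoin R x"
    unfolding adjoin_def by blast
  have "1 * x ^ 1 + 0 \<in> polys_below R x (Suc 1)"
    using polys_below_zero[of 1] subring_set_closed(2)[OF R]
    unfolding polys_below.simps(2)[of R x 1] by blast
  then have "x \<in> polys_below R x (Suc 1)"
    by (simp only: mult_1_left power_one_right add_0_right)
  then show "x \<in> adjoin R x"
    unfolding adjoin_def by blast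
qed

lemma adjoin_least:
  assumes "subring_set A" "R \<subseteq> A" "x \<in> A"
  shows "adjoin R x \<subseteq> A"
proof -
  have pow: "x ^ n \<in> A" for n
    by (induction n) (auto intro: subring_set_closed[OF assms(1)] assms(3))
  have "polys_below R x n \<subseteq> A" for n
  proof (induction n)
    case (Suc n)
    then show ?case
      using assms(2) pow by (auto intro!: subring_set_closed[OF assms(1)])
  qed (use subring_set_closed(1)[OF assms(1)] in simp)
  then show ?thesis
    unfolding adjoin_def by blast
qed

text \<open>Hilbert's argument.  If an ideal \<open>J\<close> is not finitely generated, choose successively an element \<open>g i\<close> of
\<open>J\<close> outside the ideal of the previous ones, of least possible degree \<open>k i\<close>, with leading coefficient
\<open>c i\<close>.  Some \<open>c m\<close> is an \<open>R\<close>-combination of \<open>c 0, \<dots>, c (m - 1)\<close>.  As the degrees do not decrease, the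
corresponding combination of the \<open>g i\<close>, multiplied by suitable powers of \<open>x\<close>, cancels the leading term of
\<open>g m\<close>, which contradicts the minimality of \<open>k m\<close>.\<close>

theorem noetherian_adjoin:
  assumes noeth: "noetherian_set R"
  shows "noetherian_set (adjoin R x)"
  unfolding noetherian_set_def
proof (intro allI impI)
  fix S assume S: "S \<subseteq> adjoin R x"
  let ?A = "adjoin R x" and ?J = "ideal_span (adjoin R x) S"
  note A = subring_adjoin
  note A_closed = subring_set_closed[OF A]
  have J: "?J \<subseteq> ?A"
    using ideal_span_subset_ring[OF A S] .
  have "\<exists>T. finite T \<and> T \<subseteq> ?J \<and> ?J \<subseteq> ideal_span ?A T"
  proof (rule ccontr)
    assume not_fg: "\<not> ?thesis"
    \<comment> \<open>\<open>g\<close> is a new element of least degree modulo the ideal generated by \<open>T\<close>, with leading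
      term \<open>c * x ^ k\<close>; the last conjunct is the minimality.\<close>
    define lead where "lead T t \<longleftrightarrow> (case t of (g, c, k) \<Rightarrow>
        g \<in> ?J \<and> g \<notin> ideal_span ?A T \<and> c \<in> R \<and> g - c * x ^ k \<in> polys_below R x k \<and>
        ?J \<inter> polys_below R x k \<subseteq> ideal_span ?A T)" for T t
    have ex_lead: "\<exists>t. lead T t" if T: "finite T" "T \<subseteq> ?J" for T
    proof -
      let ?bad = "\<lambda>n. \<exists>g \<in> ?J \<inter> polys_below R x n. g \<notin> ideal_span ?A T"
      define n where "n = (LEAST n. ?bad n)"
      obtain g where "g \<in> ?J" "g \<notin> ideal_span ?A T"
        using not_fg T by blast
      then have "\<exists>n. ?bad n"
        using J unfolding adjoin_def[of R x] by blast
      then have bad: "?bad n" and least: "\<not> ?bad m" if "m < n" for m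
        using that LeastI_ex[of ?bad] not_less_Least[of _ ?bad] unfolding n_def by blast+
      have "?bad n"
        using LeastI_ex[OF \<open>\<exists>n. ?bad n\<close>] unfolding n_def .
      moreover have "n \<noteq> 0"
      proof
        assume "n = 0"
        with \<open>?bad n\<close> show False
          using ideal_span.zero by auto
      qed
      then obtain k where k: "n = Suc k"
        using not0_implies_Suc by blast
      ultimately obtain c p where cp: "c \<in> R" "p \<in> polys_below R x k"
        "c * x ^ k + p \<in> ?J" "c * x ^ k + p \<notin> ideal_span ?A T"
        by auto
      then have "lead T (c * x ^ k + p, c, k)"
        using least[of k] k unfolding lead_def by auto
      then show ?thesis
        by blast
    qed
    have "\<exists>F. \<forall>i::nat. lead ((fst \<circ> F) ` {..<i}) (F i)"
    proof (rule dependent_wellorder_choice[where P = "\<lambda>f i r. lead ((fst \<circ> f) ` {..<i}) r"])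
      show "lead ((fst \<circ> f) ` {..<i}) r = lead ((fst \<circ> g) ` {..<i}) r"
        if "\<And>j. j < i \<Longrightarrow> f j = g j" for r f g and i :: nat
      proof -
        have "(fst \<circ> f) ` {..<i} = (fst \<circ> g) ` {..<i}"
          using that by (intro image_cong) auto
        then show ?thesis
          by simp
      qed
      show "\<exists>r. lead ((fst \<circ> f) ` {..<i}) r"
        if "\<And>j. j < i \<Longrightarrow> lead ((fst \<circ> f) ` {..<j}) (f j)" for f and i :: nat
      proof (rule ex_lead)
        have "fst (f j) \<in> ?J" if "j < i" for j
          using \<open>\<And>j. j < i \<Longrightarrow> lead ((fst \<circ> f) ` {..<j}) (f j)\<close>[OF that]
          unfolding lead_def case_prod_unfold by (elim conjE)
        then show "(fst \<circ> f) ` {..<i} \<subseteq> ?J"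
          by auto
      qed simp
    qed
    then obtain F where F: "\<And>i::nat. lead ((fst \<circ> F) ` {..<i}) (F i)"
      by blast
    define g where "g = fst \<circ> F"
    define c where "c = fst \<circ> snd \<circ> F"
    define k where "k = snd \<circ> snd \<circ> F"
    have gJ: "g i \<in> ?J" and new: "g i \<notin> ideal_span ?A (g ` {..<i})" and cR: "c i \<in> R"
      and lower: "g i - c i * x ^ k i \<in> polys_below R x (k i)"
      and minimal: "?J \<inter> polys_below R x (k i) \<subseteq> ideal_span ?A (g ` {..<i})" for i
      using F[of i] unfolding lead_def g_def c_def k_def by (auto simp: case_prod_unfold)
    have k_mono: "k i \<le> k j" if "i < j" for i j
    proof (rule ccontr)
      assume "\<not> k i \<le> k j"
      then have "polys_below R x (Suc (k j)) \<subseteq> polys_below R x (k i)"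
        by (intro polys_below_mono) simp
      moreover have "c j * x ^ k j + (g j - c j * x ^ k j) \<in> polys_below R x (Suc (k j))"
        using cR[of j] lower[of j] unfolding polys_below.simps by blast
      ultimately have "g j \<in> ideal_span ?A (g ` {..<i})"
        using minimal[of i] gJ[of j] by auto
      moreover have "ideal_span ?A (g ` {..<i}) \<subseteq> ideal_span ?A (g ` {..<j})"
        using that by (intro ideal_span_mono image_mono) auto
      ultimately show False
        using new[of j] by blast
    qed
    obtain m where m: "c m \<in> ideal_span R (c ` {..<m})"
      using noetherian_set_sequence[OF noeth, of c] cR by blast
    \<comment> \<open>Every combination \<open>y\<close> of the earlier leading coefficients is the leading coefficient, in
      degree \<open>k m\<close>, of an element of the ideal generated by the earlier \<open>g i\<close>.\<close>
    have "\<exists>h \<in> ideal_span ?A (g ` {..<m}). h - y * x ^ k m \<in> polys_below R x (k m)"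
      if "y \<in> ideal_span R (c ` {..<m})" for y
      using that
    proof induction
      case zero
      show ?case
        using ideal_span.zero polys_below_zero by (intro bexI[of _ 0]) auto
    next
      case (step r s y)
      then obtain h i where h: "h \<in> ideal_span ?A (g ` {..<m})"
          "h - y * x ^ k m \<in> polys_below R x (k m)"
        and i: "i < m" "s = c i"
        by blast
      let ?u = "x ^ (k m - k i)"
      have "?u \<in> ?A"
      proof -
        have "?u * 1 \<in> polys_below R x (k m - k i + 1)"
          using subring_set_closed(2)[OF R] by (intro polys_below_power) auto
        then show ?thesis
          unfolding adjoin_def mult_1_right by blast
      qed
      then have ru: "r * ?u \<in> ?A"
        using step.hyps(1) adjoin_base(1) A_closed by blast
      have kk: "k m - k i + k i = k m"
        using k_mono[OF i(1)] by simp
      have "?u * (g i - c i * x ^ k i) \<in> polys_below R x (k m)"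
        using polys_below_power[OF lower[of i], of "k m - k i"] kk by simp
      then have "r * (?u * (g i - c i * x ^ k i)) \<in> polys_below R x (k m)"
        using step.hyps(1) polys_below_scale by blast
      moreover have "?u * x ^ k i = x ^ k m"
        using kk by (simp flip: power_add)
      then have "(r * ?u * g i + h) - (r * s + y) * x ^ k m
          = r * (?u * (g i - c i * x ^ k i)) - (0 - (h - y * x ^ k m))"
        using i(2) by (simp add: algebra_simps)
      ultimately have "(r * ?u * g i + h) - (r * s + y) * x ^ k m \<in> polys_below R x (k m)"
        using h(2) polys_below_zero polys_below_diff by metis
      moreover have "r * ?u * g i + h \<in> ideal_span ?A (g ` {..<m})"
        using ru h(1) i(1) by (intro ideal_span.step) auto
      ultimately show ?case
        by blast
    qed
    then obtain h where h: "h \<in> ideal_span ?A (g ` {..<m})"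
        "h - c m * x ^ k m \<in> polys_below R x (k m)"
      using m by blast
    have "ideal_span ?A (g ` {..<m}) \<subseteq> ?J"
      using gJ by (intro ideal_span_least[OF A]) blast
    then have "g m - h \<in> ?J"
      using gJ h(1) by (intro ideal_span_diff[OF A]) auto
    moreover have "g m - h \<in> polys_below R x (k m)"
      using polys_below_diff[OF lower[of m] h(2)] by simp
    ultimately have "g m - h \<in> ideal_span ?A (g ` {..<m})"
      using minimal[of m] by blast
    then have "g m \<in> ideal_span ?A (g ` {..<m})"
      using ideal_span_add[OF _ h(1)] by fastforce
    then show False
      using new by blast
  qed
  then obtain T where T: "finite T" "T \<subseteq> ?J" "?J \<subseteq> ideal_span ?A T"
    by blast
  obtain T' where T': "finite T'" "T' \<subseteq> S" "T \<subseteq> ideal_span ?A T'"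
    using ideal_span_finite_support[OF T(1,2)] by blast
  have "S \<subseteq> ?J"
    using ideal_span_base[OF A] by blast
  then have "S \<subseteq> ideal_span ?A T'"
    using T(3) ideal_span_least[OF A T'(3)] by blast
  then show "\<exists>T\<subseteq>S. finite T \<and> S \<subseteq> ideal_span ?A T"
    using T' by blast
qed

end

section \<open>Noetherian property and irreducible components of the Zariski topology\<close>

lemma noetherian_constants:
  "noetherian_set (range (\<lambda>c (x :: 'a). c :: complex))"
  unfolding noetherian_set_def
proof (intro allI impI)
  let ?C = "range (\<lambda>c (x :: 'a). c :: complex)"
  fix S assume S: "S \<subseteq> ?C"
  show "\<exists>T\<subseteq>S. finite T \<and> S \<subseteq> ideal_span ?C T"
  proof (cases "S \<subseteq> {0}")
    case True
    then show ?thesis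
      by (intro exI[of _ "{}"]) (auto intro: ideal_span.zero)
  next
    case False
    then obtain c where c: "(\<lambda>x. c) \<in> S" "c \<noteq> 0"
      using S by (force simp: zero_fun_def)
    have "f \<in> ideal_span ?C {\<lambda>x. c}" if f: "f \<in> S" for f
    proof -
      obtain d where d: "f = (\<lambda>x. d)"
        using subsetD[OF S f] by blast
      have "(\<lambda>x. d / c) * (\<lambda>x. c) + 0 \<in> ideal_span ?C {\<lambda>x. c}"
        by (intro ideal_span.intros) auto
      then show ?thesis
        using c(2) unfolding d by (simp add: times_fun_def plus_fun_def zero_fun_def)
    qed
    then show ?thesis
      using c(1) by (intro exI[of _ "{\<lambda>x. c}"]) auto
  qed
qed

lemma complex_polynomial_function_diff:
  assumes "complex_polynomial_function p" "complex_polynomial_function q"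
  shows "complex_polynomial_function (\<lambda>x. p x - q x)"
  using complex_polynomial_function.add[OF assms(1)
      complex_polynomial_function.mult[OF complex_polynomial_function.const[of "-1"] assms(2)]]
  by simp

lemma complex_polynomial_function_combination:
  assumes "\<And>g. g \<in> B \<Longrightarrow> complex_polynomial_function g"
  shows "complex_polynomial_function (\<lambda>x. \<Sum>g\<in>B. c g * g x)"
proof (cases "finite B")
  case True
  then show ?thesis
    using assms
  proof (induction rule: finite_induct)
    case (insert f B)
    then have "complex_polynomial_function (\<lambda>x. c f * f x + (\<Sum>g\<in>B. c g * g x))"
      by (intro complex_polynomial_function.add complex_polynomial_function.mult
          complex_polynomial_function.const) auto
    then show ?case
      using insert.hyps by simp
  qed (simp add: complex_polynomial_function.const)
qed (simp add: complex_polynomial_function.const)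

lemma subring_polynomial_functions: "subring_set (Collect complex_polynomial_function)"
  using complex_polynomial_function.const[of 1] complex_polynomial_function_diff
    complex_polynomial_function.mult
  by (auto simp: subring_set_def one_fun_def fun_diff_def times_fun_def)

text \<open>Starting from the field of constants, the coordinate functions are adjoined one at a time.\<close>

theorem noetherian_polynomial_functions:
  "noetherian_set (Collect (complex_polynomial_function :: (complex ^ 'n \<Rightarrow> complex) \<Rightarrow> bool))"
proof -
  let ?P = "Collect (complex_polynomial_function :: (complex ^ 'n \<Rightarrow> complex) \<Rightarrow> bool)"
  have "\<exists>R. subring_set R \<and> noetherian_set R \<and> R \<subseteq> ?P \<and> range (\<lambda>c x. c) \<subseteq> R \<and>
      (\<forall>i\<in>I. (\<lambda>x. x $ i) \<in> R)" if "finite I" for I :: "'n set"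
    using that
  proof (induction I rule: finite_induct)
    case empty
    have "subring_set (range (\<lambda>c (x :: complex ^ 'n). c :: complex))"
      by (auto simp: subring_set_def one_fun_def fun_diff_def times_fun_def)
    then show ?case
      using noetherian_constants[where 'a = "complex ^ 'n"]
      by (intro exI[of _ "range (\<lambda>c x. c)"]) (auto intro: complex_polynomial_function.const)
  next
    case (insert i I)
    then obtain R where R: "subring_set R" "noetherian_set R" "R \<subseteq> ?P" "range (\<lambda>c x. c) \<subseteq> R"
      "\<forall>i\<in>I. (\<lambda>x. x $ i) \<in> R"
      by blast
    let ?R' = "adjoin R (\<lambda>x. x $ i)"
    have "?R' \<subseteq> ?P"
      using R(3) by (intro adjoin_least[OF R(1) subring_polynomial_functions])
        (auto intro: complex_polynomial_function.coord)
    moreover have "range (\<lambda>c x. c) \<subseteq> ?R'"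
      using R(4) adjoin_base(1)[OF R(1)] by (rule order_trans)
    moreover have "\<forall>j\<in>insert i I. (\<lambda>x. x $ j) \<in> ?R'"
      using R(5) adjoin_base[OF R(1), of "\<lambda>x. x $ i"] by auto
    ultimately show ?case
      using subring_adjoin[OF R(1)] noetherian_adjoin[OF R(1,2)] by metis
  qed
  from this[of UNIV] obtain R where R: "subring_set R" "noetherian_set R" "R \<subseteq> ?P"
    "range (\<lambda>c x. c) \<subseteq> R" "\<And>i. (\<lambda>x. x $ i) \<in> R"
    by auto
  have "p \<in> R" if "complex_polynomial_function p" for p
    using that
  proof induction
    case (add p q)
    then show ?case
      using subring_set_closed(6)[OF R(1)] by (fastforce simp: plus_fun_def)
  next
    case (mult p q)
    then show ?case
      using subring_set_closed(4)[OF R(1)] by (fastforce simp: times_fun_def)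
  qed (use R(4,5) in auto)
  then have "R = ?P"
    using R(3) by auto
  then show ?thesis
    using R(2) by simp
qed

lemma ideal_span_vanishes:
  assumes "p \<in> ideal_span R S" "\<And>s. s \<in> S \<Longrightarrow> s a = 0"
  shows "p a = 0"
  using assms(1)
proof induction
  case (step r s y)
  then show ?case
    using assms(2)[OF step.hyps(2)] by simp
qed simp

text \<open>Along a strictly descending chain choose \<open>p i\<close> vanishing on \<open>Z (Suc i)\<close> but not on \<open>Z i\<close>.  Some \<open>p m\<close>
would lie in the ideal generated by its predecessors, all of which vanish on \<open>Z m\<close>.\<close>

lemma wf_algebraic_sets:
  "wf {(Z', Z :: (complex ^ 'n) set). algebraic_set Z' \<and> algebraic_set Z \<and> Z' \<subset> Z}"
  unfolding wf_iff_no_infinite_down_chain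
proof (rule notI, elim exE)
  fix Z :: "nat \<Rightarrow> (complex ^ 'n) set"
  assume "\<forall>i. (Z (Suc i), Z i) \<in> {(Z', Z). algebraic_set Z' \<and> algebraic_set Z \<and> Z' \<subset> Z}"
  then have alg: "algebraic_set (Z i)" and desc: "Z (Suc i) \<subset> Z i" for i
    by auto
  have "\<exists>p. complex_polynomial_function p \<and> (\<forall>a\<in>Z (Suc i). p a = 0) \<and> (\<exists>a\<in>Z i. p a \<noteq> 0)" for i
  proof -
    obtain P where "\<forall>p\<in>P. complex_polynomial_function p" "Z (Suc i) = zero_locus P"
      using alg[of "Suc i"] unfolding algebraic_set_def by blast
    then show ?thesis
      using desc[of i] unfolding zero_locus_def by blast
  qed
  then obtain p where p: "\<And>i. complex_polynomial_function (p i)"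
    "\<And>i a. a \<in> Z (Suc i) \<Longrightarrow> p i a = 0" "\<And>i. \<exists>a\<in>Z i. p i a \<noteq> 0"
    by metis
  obtain m where m: "p m \<in> ideal_span (Collect complex_polynomial_function) (p ` {..<m})"
    using noetherian_set_sequence[OF noetherian_polynomial_functions, of p] p(1) by blast
  have dec: "Z n \<subseteq> Z k" if "k \<le> n" for k n
    using that by (rule lift_Suc_antimono_le[rotated]) (use desc in blast)
  obtain a where a: "a \<in> Z m" "p m a \<noteq> 0"
    using p(3) by blast
  have "s a = 0" if s: "s \<in> p ` {..<m}" for s
  proof -
    obtain i where i: "s = p i" "Suc i \<le> m"
      using s by (auto simp: Suc_le_eq)
    then show ?thesis
      using p(2)[of a i] dec[OF i(2)] a(1) by auto
  qed
  then show False
    using ideal_span_vanishes[OF m] a(2) by blast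
qed

lemma finite_irreducible_decomposition:
  fixes Z :: "(complex ^ 'n) set"
  assumes "algebraic_set Z"
  shows "\<exists>K. finite K \<and> \<Union>K = Z \<and> (\<forall>S\<in>K. algebraic_set S \<and> irreducible_in zariski S)"
  using assms
proof (induction Z rule: wf_induct_rule[OF wf_algebraic_sets])
  case (1 Z)
  show ?case
  proof (cases "Z = {} \<or> irreducible_in zariski Z")
    case True
    then show ?thesis
    proof
      assume "Z = {}"
      then show ?thesis
        by (intro exI[of _ "{}"]) auto
    next
      assume "irreducible_in zariski Z"
      then show ?thesis
        using 1 by (intro exI[of _ "{Z}"]) auto
    qed
  next
    case False
    then obtain A B where AB: "algebraic_set A" "algebraic_set B" "Z \<subseteq> A \<union> B"
      "\<not> Z \<subseteq> A" "\<not> Z \<subseteq> B"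
      unfolding irreducible_in_def closedin_zariski by auto
    have alg: "algebraic_set (Z \<inter> C)" if "algebraic_set C" for C
      using closedin_Int[of zariski Z C] 1(2) that by (simp add: closedin_zariski)
    have smaller: "\<exists>K. finite K \<and> \<Union>K = Z \<inter> C \<and>
        (\<forall>S\<in>K. algebraic_set S \<and> irreducible_in zariski S)"
      if "algebraic_set C" "\<not> Z \<subseteq> C" for C
      using alg[OF that(1)] that(2) 1(2) by (intro 1(1)) auto
    obtain KA KB where
      "finite KA" "\<Union>KA = Z \<inter> A" "\<forall>S\<in>KA. algebraic_set S \<and> irreducible_in zariski S"
      "finite KB" "\<Union>KB = Z \<inter> B" "\<forall>S\<in>KB. algebraic_set S \<and> irreducible_in zariski S"
      using smaller[OF AB(1,4)] smaller[OF AB(2,5)] by (elim exE conjE)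
    moreover from this have "\<Union>(KA \<union> KB) = Z"
      using AB(3) by auto
    ultimately show ?thesis
      by (intro exI[of _ "KA \<union> KB"]) auto
  qed
qed

lemma irreducible_in_finite_Union:
  assumes "irreducible_in T S" "finite K" "\<And>C. C \<in> K \<Longrightarrow> closedin T C" "S \<subseteq> \<Union>K"
  shows "\<exists>C\<in>K. S \<subseteq> C"
  using assms(2-4)
proof (induction K rule: finite_induct)
  case empty
  then show ?case
    using assms(1) by (simp add: irreducible_in_def)
next
  case (insert C K)
  have "closedin T (\<Union>K)"
    using insert by (intro closedin_Union) auto
  then have "S \<subseteq> C \<or> S \<subseteq> \<Union>K"
    using insert.prems assms(1) unfolding irreducible_in_def by simp
  then show ?case
    using insert by auto
qed

text \<open>Otherwise the remaining ones among the finitely many irreducible pieces of the closure would form a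
closed set containing \<open>D\<close>, hence the whole closure; then \<open>Y\<close> would be properly contained in one of them.\<close>

lemma irreducible_component_meets_dense_set:
  fixes D :: "(complex ^ 'n) set"
  assumes "Y \<in> irreducible_components zariski (zariski closure_of D)"
  shows "Y \<inter> D \<noteq> {}"
proof
  assume disjoint: "Y \<inter> D = {}"
  let ?X = "zariski closure_of D"
  have Y: "Y \<subseteq> ?X" "irreducible_in zariski Y"
    and max: "\<And>S. Y \<subseteq> S \<Longrightarrow> S \<subseteq> ?X \<Longrightarrow> irreducible_in zariski S \<Longrightarrow> S = Y"
    using assms unfolding irreducible_components_def by auto
  have "algebraic_set ?X"
    using closedin_closure_of[of zariski D] unfolding closedin_zariski .
  then obtain K where K: "finite K" "\<Union>K = ?X"
    "\<forall>S\<in>K. algebraic_set S \<and> irreducible_in zariski S"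
    using finite_irreducible_decomposition[OF \<open>algebraic_set ?X\<close>] by (elim exE conjE)
  have "D \<subseteq> ?X"
    by (intro closure_of_subset) simp
  then have "D \<subseteq> \<Union>(K - {Y})"
    using disjoint K(2) by blast
  moreover have "closedin zariski (\<Union>(K - {Y}))"
    using K by (intro closedin_Union) (auto simp: closedin_zariski)
  ultimately have "?X \<subseteq> \<Union>(K - {Y})"
    by (rule closure_of_minimal)
  then have "\<exists>C\<in>K - {Y}. Y \<subseteq> C"
    using Y K by (intro irreducible_in_finite_Union) (auto simp: closedin_zariski)
  then show False
    using max K(2,3) by blast
qed

lemma dense_open_in_irreducible:
  assumes "irreducible_in T Y" "openin T W" "Y \<inter> W \<noteq> {}"
  shows "dense_open_in T Y (Y \<inter> W)"
proof -
  have Y: "Y \<subseteq> topspace T"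
    using assms(1) by (simp add: irreducible_in_def)
  have "Y \<subseteq> T closure_of (Y \<inter> W) \<union> (topspace T - W)"
    using closure_of_subset[of "Y \<inter> W" T] Y by blast
  moreover have "closedin T (topspace T - W)"
    using assms(2) by (rule openin_closedin_eq[THEN iffD1, THEN conjunct2])
  ultimately have "Y \<subseteq> T closure_of (Y \<inter> W) \<or> Y \<subseteq> topspace T - W"
    using assms(1) unfolding irreducible_in_def by (metis closedin_closure_of)
  then have "Y \<subseteq> T closure_of (Y \<inter> W)"
    using assms(3) by blast
  then have "subtopology T Y closure_of (Y \<inter> W) = Y"
    by (auto simp: closure_of_subtopology)
  then show ?thesis
    unfolding dense_open_in_def using assms(2) by (auto simp: openin_subtopology)
qed

lemma zariski_closure_iff:
  "a \<in> zariski closure_of S \<longleftrightarrow>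
    (\<forall>p. complex_polynomial_function p \<longrightarrow> (\<forall>x\<in>S. p x = 0) \<longrightarrow> p a = 0)"
proof
  assume a: "a \<in> zariski closure_of S"
  show "\<forall>p. complex_polynomial_function p \<longrightarrow> (\<forall>x\<in>S. p x = 0) \<longrightarrow> p a = 0"
  proof (intro allI impI)
    fix p :: "complex ^ 'a \<Rightarrow> complex"
    assume p: "complex_polynomial_function p" "\<forall>x\<in>S. p x = 0"
    have "closedin zariski (zero_locus {p})"
      unfolding closedin_zariski algebraic_set_def using p(1) by blast
    moreover have "S \<subseteq> zero_locus {p}"
      using p(2) by (auto simp: zero_locus_def)
    ultimately have "a \<in> zero_locus {p}"
      using closure_of_minimal a by blast
    then show "p a = 0"
      by (simp add: zero_locus_def)
  qed
next
  assume a: "\<forall>p. complex_polynomial_function p \<longrightarrow> (\<forall>x\<in>S. p x = 0) \<longrightarrow> p a = 0"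
  have "algebraic_set (zariski closure_of S)"
    using closedin_closure_of[of zariski S] unfolding closedin_zariski .
  then obtain P where P: "\<forall>p\<in>P. complex_polynomial_function p" "zariski closure_of S = zero_locus P"
    unfolding algebraic_set_def by blast
  then have "S \<subseteq> zero_locus P"
    using closure_of_subset[of S zariski] by simp
  then show "a \<in> zariski closure_of S"
    unfolding P(2) using a P(1) unfolding zero_locus_def by blast
qed

section \<open>Regular fractions\<close>

text \<open>The denominator has no zero on \<open>G\<close>, so a function with this property is continuous on \<open>G\<close> for the
Zariski topology.  One global quotient is required, instead of a quotient around every point: the iterates
of the mutation are of this form, and the property is stable under the field operations and composition.\<close>

definition fraction_on :: "(complex ^ 'n) set \<Rightarrow> (complex ^ 'n \<Rightarrow> complex) \<Rightarrow> bool" where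
  "fraction_on G h \<longleftrightarrow> (\<exists>p q. complex_polynomial_function p \<and> complex_polynomial_function q \<and>
     (\<forall>a\<in>G. q a \<noteq> 0 \<and> h a = p a / q a))"

lemma fraction_on_polynomial:
  "complex_polynomial_function p \<Longrightarrow> fraction_on G p"
  unfolding fraction_on_def
  by (intro exI[of _ p] exI[of _ "\<lambda>x. 1"]) (auto intro: complex_polynomial_function.const)

lemma fraction_on_subset: "fraction_on G h \<Longrightarrow> H \<subseteq> G \<Longrightarrow> fraction_on H h"
  unfolding fraction_on_def by blast

lemma fraction_on_add:
  assumes "fraction_on G h" "fraction_on G h'"
  shows "fraction_on G (\<lambda>a. h a + h' a)"
proof -
  obtain p q p' q' where "complex_polynomial_function p" "complex_polynomial_function q"
    "complex_polynomial_function p'" "complex_polynomial_function q'"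
    "\<forall>a\<in>G. q a \<noteq> 0 \<and> h a = p a / q a" "\<forall>a\<in>G. q' a \<noteq> 0 \<and> h' a = p' a / q' a"
    using assms unfolding fraction_on_def by blast
  then show ?thesis
    unfolding fraction_on_def
    by (intro exI[of _ "\<lambda>a. p a * q' a + p' a * q a"] exI[of _ "\<lambda>a. q a * q' a"])
      (auto intro!: complex_polynomial_function.intros simp: add_frac_eq)
qed

lemma fraction_on_mult:
  assumes "fraction_on G h" "fraction_on G h'"
  shows "fraction_on G (\<lambda>a. h a * h' a)"
proof -
  obtain p q p' q' where "complex_polynomial_function p" "complex_polynomial_function q"
    "complex_polynomial_function p'" "complex_polynomial_function q'"
    "\<forall>a\<in>G. q a \<noteq> 0 \<and> h a = p a / q a" "\<forall>a\<in>G. q' a \<noteq> 0 \<and> h' a = p' a / q' a"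
    using assms unfolding fraction_on_def by blast
  then show ?thesis
    unfolding fraction_on_def
    by (intro exI[of _ "\<lambda>a. p a * p' a"] exI[of _ "\<lambda>a. q a * q' a"])
      (auto intro!: complex_polynomial_function.intros)
qed

lemma fraction_on_diff:
  assumes "fraction_on G h" "fraction_on G h'"
  shows "fraction_on G (\<lambda>a. h a - h' a)"
  using fraction_on_add[OF assms(1) fraction_on_mult[OF
        fraction_on_polynomial[OF complex_polynomial_function.const[of "-1"]] assms(2)]]
  by simp

lemma fraction_on_divide:
  assumes "fraction_on G h" "fraction_on G h'" "\<And>a. a \<in> G \<Longrightarrow> h' a \<noteq> 0"
  shows "fraction_on G (\<lambda>a. h a / h' a)"
proof -
  obtain p q p' q' where "complex_polynomial_function p" "complex_polynomial_function q"
    "complex_polynomial_function p'" "complex_polynomial_function q'"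
    "\<forall>a\<in>G. q a \<noteq> 0 \<and> h a = p a / q a" "\<forall>a\<in>G. q' a \<noteq> 0 \<and> h' a = p' a / q' a"
    using assms(1,2) unfolding fraction_on_def by blast
  moreover from this have "\<forall>a\<in>G. p' a \<noteq> 0"
    using assms(3) by fastforce
  ultimately show ?thesis
    unfolding fraction_on_def
    by (intro exI[of _ "\<lambda>a. p a * q' a"] exI[of _ "\<lambda>a. q a * p' a"])
      (auto intro!: complex_polynomial_function.intros)
qed

lemma fraction_on_prod:
  assumes "\<And>e. e \<in> E \<Longrightarrow> fraction_on G (h e)"
  shows "fraction_on G (\<lambda>a. \<Prod>e\<in>E. h e a)"
proof (cases "finite E")
  case True
  then show ?thesis
    using assms by (induction rule: finite_induct)
      (auto intro: fraction_on_mult fraction_on_polynomial complex_polynomial_function.const)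
next
  case False
  then show ?thesis
    by (auto intro: fraction_on_polynomial complex_polynomial_function.const)
qed

lemma fraction_on_compose:
  assumes "complex_polynomial_function p" "\<And>k. fraction_on G (\<lambda>a. v a $ k)"
  shows "fraction_on G (\<lambda>a. p (v a))"
  using assms(1)
  by induction (auto intro: assms(2) fraction_on_add fraction_on_mult fraction_on_polynomial
      complex_polynomial_function.const)

lemma openin_fraction_nonzero:
  assumes "fraction_on G h" "openin zariski G"
  shows "openin zariski {a \<in> G. h a \<noteq> 0}"
proof -
  obtain p q where pq: "complex_polynomial_function p" "\<forall>a\<in>G. q a \<noteq> 0 \<and> h a = p a / q a"
    using assms(1) unfolding fraction_on_def by blast
  have "algebraic_set (zero_locus {p})"
    unfolding algebraic_set_def using pq(1) by blast
  then have "openin zariski (G \<inter> - zero_locus {p})"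
    using assms(2) by (intro openin_Int) (auto simp: openin_zariski)
  moreover have "{a \<in> G. h a \<noteq> 0} = G \<inter> - zero_locus {p}"
    using pq(2) by (auto simp: zero_locus_def)
  ultimately show ?thesis
    by simp
qed

text \<open>Continuity of maps given by fractions: a polynomial \<open>p\<close> vanishing on \<open>v ` S\<close> pulls back to a fraction, and
its numerator vanishes on \<open>S\<close>, hence at \<open>a\<close>.\<close>

lemma fraction_map_closure:
  assumes "\<And>k. fraction_on G (\<lambda>a. v a $ k)" "S \<subseteq> G" "a \<in> G" "a \<in> zariski closure_of S"
  shows "v a \<in> zariski closure_of (v ` S)"
  unfolding zariski_closure_iff
proof (intro allI impI)
  fix p assume p: "complex_polynomial_function p" "\<forall>x\<in>v ` S. p x = 0"
  obtain P D where PD: "complex_polynomial_function P" "\<forall>a\<in>G. D a \<noteq> 0 \<and> p (v a) = P a / D a"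
    using fraction_on_compose[OF p(1) assms(1)] unfolding fraction_on_def by blast
  then have "\<forall>x\<in>S. P x = 0"
    using p(2) assms(2) by fastforce
  then have "P a = 0"
    using assms(4) PD(1) unfolding zariski_closure_iff by blast
  then show "p (v a) = 0"
    using PD(2) assms(3) by simp
qed

section \<open>Linear independence along a sequence is an open condition\<close>

text \<open>Up to factors that are nonzero wherever \<open>D\<close> is nonzero, \<open>D\<close> is a minor of the matrix of the values
\<open>h j s\<close>, with rows indexed by \<open>j\<close> and columns by \<open>s\<close>.  It is obtained by Gaussian elimination without
divisions: pick a column \<open>r\<close> in which the new row \<open>i\<close> has the pivot \<open>h i r b \<noteq> 0\<close>, and use it to clear
column \<open>r\<close> of the other rows.\<close>

lemma independence_open:
  fixes h :: "'j \<Rightarrow> nat \<Rightarrow> 'a \<Rightarrow> complex"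
  assumes mult: "\<And>f g. f \<in> R \<Longrightarrow> g \<in> R \<Longrightarrow> (\<lambda>x. f x * g x) \<in> R"
    and diff: "\<And>f g. f \<in> R \<Longrightarrow> g \<in> R \<Longrightarrow> (\<lambda>x. f x - g x) \<in> R"
    and one: "(\<lambda>x. 1) \<in> R"
    and "finite J"
    and "\<And>j s. j \<in> J \<Longrightarrow> h j s \<in> R"
    and "\<And>c. (\<forall>s. (\<Sum>j\<in>J. c j * h j s b) = 0) \<Longrightarrow> \<forall>j\<in>J. c j = 0"
  shows "\<exists>D\<in>R. D b \<noteq> 0 \<and>
    (\<forall>a. D a \<noteq> 0 \<longrightarrow> (\<forall>c. (\<forall>s. (\<Sum>j\<in>J. c j * h j s a) = 0) \<longrightarrow> (\<forall>j\<in>J. c j = 0)))"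
  using assms(4-6)
proof (induction J arbitrary: h rule: finite_induct)
  case empty
  then show ?case
    using one by (intro bexI[of _ "\<lambda>x. 1"]) auto
next
  case (insert i J)
  have "\<exists>r. h i r b \<noteq> 0"
  proof (rule ccontr)
    assume "\<nexists>r. h i r b \<noteq> 0"
    then have "\<forall>s. (\<Sum>j\<in>insert i J. (if j = i then 1 else 0) * h j s b) = 0"
      using insert.hyps by (auto intro!: sum.neutral)
    then show False
      using insert.prems(2)[of "\<lambda>j. if j = i then 1 else 0"] by auto
  qed
  then obtain r where r: "h i r b \<noteq> 0"
    by blast
  define g where "g j s = (\<lambda>x. h j s x * h i r x - h i s x * h j r x)" for j s
  have g_sum: "(\<Sum>j\<in>J. c j * g j s x) =
      h i r x * (\<Sum>j\<in>J. c j * h j s x) - h i s x * (\<Sum>j\<in>J. c j * h j r x)" for c s x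
    unfolding g_def by (simp add: sum_subtractf sum_distrib_left algebra_simps)
  have "\<exists>D\<in>R. D b \<noteq> 0 \<and>
    (\<forall>a. D a \<noteq> 0 \<longrightarrow> (\<forall>c. (\<forall>s. (\<Sum>j\<in>J. c j * g j s a) = 0) \<longrightarrow> (\<forall>j\<in>J. c j = 0)))"
  proof (rule insert.IH)
    show "g j s \<in> R" if "j \<in> J" for j s
      unfolding g_def using that insert.prems(1) by (intro diff mult) auto
    show "\<forall>j\<in>J. c j = 0" if c: "\<forall>s. (\<Sum>j\<in>J. c j * g j s b) = 0" for c
    proof -
      \<comment> \<open>By bilinearity a relation between the \<open>g j\<close> at \<open>b\<close> is a relation between the \<open>h j\<close>
        at \<open>b\<close>, in which row \<open>i\<close> absorbs the subtracted multiples of the pivot row.\<close>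
      define c' where "c' j = (if j = i then - (\<Sum>j\<in>J. c j * h j r b) else h i r b * c j)" for j
      have "(\<Sum>j\<in>J. c' j * h j s b) = h i r b * (\<Sum>j\<in>J. c j * h j s b)" for s
        unfolding sum_distrib_left using insert.hyps(2)
        by (intro sum.cong) (auto simp: c'_def)
      then have "(\<Sum>j\<in>insert i J. c' j * h j s b) = (\<Sum>j\<in>J. c j * g j s b)" for s
        using insert.hyps unfolding g_sum by (simp add: c'_def)
      then have "\<forall>j\<in>insert i J. c' j = 0"
        using c by (intro insert.prems(2)) simp
      then show ?thesis
        using r insert.hyps(2) by (auto simp: c'_def split: if_splits)
    qed
  qed
  then obtain D where D: "D \<in> R" "D b \<noteq> 0"
    "\<And>a c. D a \<noteq> 0 \<Longrightarrow> (\<forall>s. (\<Sum>j\<in>J. c j * g j s a) = 0) \<Longrightarrow> \<forall>j\<in>J. c j = 0"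
    by blast
  show ?case
  proof (intro bexI[of _ "\<lambda>x. D x * h i r x"] conjI allI impI)
    show "(\<lambda>x. D x * h i r x) \<in> R"
      using D(1) insert.prems(1) by (intro mult) auto
    show "D b * h i r b \<noteq> 0"
      using D(2) r by simp
    fix a c
    assume a: "D a * h i r a \<noteq> 0" and c: "\<forall>s. (\<Sum>j\<in>insert i J. c j * h j s a) = 0"
    have sum: "(\<Sum>j\<in>J. c j * h j s a) = - (c i * h i s a)" for s
      using c insert.hyps by (simp add: eq_neg_iff_add_eq_0 add.commute)
    have "\<forall>s. (\<Sum>j\<in>J. c j * g j s a) = 0"
      unfolding g_sum sum by simp
    then have J: "\<forall>j\<in>J. c j = 0"
      using a D(3) by auto
    then have "c i * h i r a = 0"
      using sum[of r] by simp
    then show "\<forall>j\<in>insert i J. c j = 0"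
      using a J by simp
  qed
qed

section \<open>Bases of finite sets of functions\<close>

text \<open>Linear algebra modulo the functions that vanish on \<open>S\<close>.\<close>

definition independent_on :: "'a set \<Rightarrow> ('a \<Rightarrow> complex) set \<Rightarrow> bool" where
  "independent_on S B \<longleftrightarrow> (\<forall>c. (\<forall>x\<in>S. (\<Sum>g\<in>B. c g * g x) = 0) \<longrightarrow> (\<forall>g\<in>B. c g = 0))"

definition combination_on :: "'a set \<Rightarrow> ('a \<Rightarrow> complex) set \<Rightarrow> ('a \<Rightarrow> complex) \<Rightarrow> bool" where
  "combination_on S B p \<longleftrightarrow> (\<exists>c. \<forall>x\<in>S. p x = (\<Sum>g\<in>B. c g * g x))"

lemma combination_on_insert:
  assumes "finite B" "combination_on S B p"
  shows "combination_on S (insert f B) p"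
proof (cases "f \<in> B")
  case False
  obtain c where c: "\<forall>x\<in>S. p x = (\<Sum>g\<in>B. c g * g x)"
    using assms(2) unfolding combination_on_def by blast
  have "(\<Sum>g\<in>B. (c(f := 0)) g * g x) = (\<Sum>g\<in>B. c g * g x)" for x
    using False by (intro sum.cong) auto
  then have "\<forall>x\<in>S. p x = (\<Sum>g\<in>insert f B. (c(f := 0)) g * g x)"
    using c assms(1) False by simp
  then show ?thesis
    unfolding combination_on_def by blast
qed (use assms(2) in \<open>simp add: insert_absorb\<close>)

lemma combination_on_member:
  assumes "finite B" "f \<in> B"
  shows "combination_on S B f"
  unfolding combination_on_def
  by (rule exI[of _ "\<lambda>g. if g = f then 1 else 0"]) (use assms in \<open>simp add: if_distrib[of "\<lambda>z. z * _"] cong: if_cong\<close>)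

lemma combination_on_axpy:
  assumes "combination_on S B p" "combination_on S B q"
  shows "combination_on S B (\<lambda>x. u * p x + q x)"
proof -
  obtain c d where "\<forall>x\<in>S. p x = (\<Sum>g\<in>B. c g * g x)" "\<forall>x\<in>S. q x = (\<Sum>g\<in>B. d g * g x)"
    using assms unfolding combination_on_def by blast
  then have "\<forall>x\<in>S. u * p x + q x = (\<Sum>g\<in>B. (u * c g + d g) * g x)"
    by (simp add: sum_distrib_left sum.distrib algebra_simps)
  then show ?thesis
    unfolding combination_on_def by (intro exI[of _ "\<lambda>g. u * c g + d g"])
qed

lemma exists_basis_on:
  assumes "finite F"
  shows "\<exists>B\<subseteq>F. independent_on S B \<and> (\<forall>f\<in>F. combination_on S B f)"
  using assms
proof (induction F rule: finite_induct)
  case empty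
  then show ?case
    by (auto simp: independent_on_def)
next
  case (insert f F)
  then obtain B where B: "B \<subseteq> F" "independent_on S B" "\<forall>f\<in>F. combination_on S B f"
    by blast
  then have fin: "finite B"
    using insert.hyps(1) finite_subset by blast
  show ?case
  proof (cases "combination_on S B f")
    case True
    then show ?thesis
      using B by (intro exI[of _ B]) auto
  next
    case False
    then have "f \<notin> B"
      using combination_on_member fin by blast
    have "independent_on S (insert f B)"
      unfolding independent_on_def
    proof (intro allI impI)
      fix c assume "\<forall>x\<in>S. (\<Sum>g\<in>insert f B. c g * g x) = 0"
      then have sum: "\<forall>x\<in>S. c f * f x + (\<Sum>g\<in>B. c g * g x) = 0"
        using fin \<open>f \<notin> B\<close> by simp
      have "c f = 0"
      proof (rule ccontr)
        assume "c f \<noteq> 0"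
        have "f x = (\<Sum>g\<in>B. (- c g / c f) * g x)" if "x \<in> S" for x
        proof -
          have "(\<Sum>g\<in>B. (- c g / c f) * g x) = - (\<Sum>g\<in>B. c g * g x) / c f"
            by (simp add: sum_negf sum_divide_distrib)
          also have "- (\<Sum>g\<in>B. c g * g x) = c f * f x"
            using bspec[OF sum that] by (simp add: neg_eq_iff_add_eq_0 add.commute)
          finally show ?thesis
            using \<open>c f \<noteq> 0\<close> by simp
        qed
        then have "combination_on S B f"
          unfolding combination_on_def by (intro exI[of _ "\<lambda>g. - c g / c f"] ballI)
        then show False
          using False by contradiction
      qed
      moreover from this have "\<forall>g\<in>B. c g = 0"
        using sum B(2) unfolding independent_on_def by simp
      ultimately show "\<forall>g\<in>insert f B. c g = 0"
        by simp
    qed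
    then show ?thesis
      using B(1,3) fin combination_on_insert[OF fin] combination_on_member[of "insert f B" f S]
      by (intro exI[of _ "insert f B"] conjI ballI) auto
  qed
qed

section \<open>Monomials\<close>

text \<open>Indexing monomials by words in the variables lists most of them repeatedly, but turns products into
concatenations and makes the countability of the index type immediate.\<close>

definition monomial :: "'n list \<Rightarrow> complex ^ 'n \<Rightarrow> complex" where
  "monomial w x = prod_list (map (\<lambda>i. x $ i) w)"

lemma monomial_polynomial: "complex_polynomial_function (monomial w)"
proof (induction w)
  case Nil
  then show ?case
    using complex_polynomial_function.const[of 1] by (simp add: monomial_def[abs_def])
next
  case (Cons i w)
  then show ?case
    using complex_polynomial_function.mult[OF complex_polynomial_function.coord Cons]
    by (simp add: monomial_def[abs_def])
qed

inductive monomial_sum :: "(complex ^ 'n \<Rightarrow> complex) \<Rightarrow> bool" where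
  zero: "monomial_sum (\<lambda>x. 0)"
| step: "monomial_sum p \<Longrightarrow> monomial_sum (\<lambda>x. c * monomial w x + p x)"

lemma monomial_sum_add:
  assumes "monomial_sum p" "monomial_sum q"
  shows "monomial_sum (\<lambda>x. p x + q x)"
  using assms(1)
proof induction
  case (step p c w)
  then show ?case
    using monomial_sum.step[OF step.IH, of c w] by (simp add: add.assoc)
qed (simp add: assms(2))

lemma monomial_sum_scale:
  assumes "monomial_sum p"
  shows "monomial_sum (\<lambda>x. d * monomial v x * p x)"
  using assms
proof induction
  case (step p c w)
  have "monomial (v @ w) x = monomial v x * monomial w x" for x :: "complex ^ 'a"
    by (simp add: monomial_def)
  then show ?case
    using monomial_sum.step[OF step.IH, of "d * c" "v @ w"] by (simp add: algebra_simps)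
qed (simp add: monomial_sum.zero)

lemma monomial_sum_mult:
  assumes "monomial_sum p" "monomial_sum q"
  shows "monomial_sum (\<lambda>x. p x * q x)"
  using assms(1)
proof induction
  case (step p c w)
  then show ?case
    using monomial_sum_add[OF monomial_sum_scale[OF assms(2), of c w] step.IH]
    by (simp add: algebra_simps)
qed (simp add: monomial_sum.zero)

lemma polynomial_monomial_sum:
  "complex_polynomial_function p \<Longrightarrow> monomial_sum p"
proof (induction rule: complex_polynomial_function.induct)
  case (coord i)
  then show ?case
    using monomial_sum.step[OF monomial_sum.zero, of 1 "[i]"] by (simp add: monomial_def)
next
  case (const c)
  then show ?case
    using monomial_sum.step[OF monomial_sum.zero, of c "[]"] by (simp add: monomial_def)
qed (auto intro: monomial_sum_add monomial_sum_mult)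

definition first_monomials :: "nat \<Rightarrow> (complex ^ 'n \<Rightarrow> complex) set" where
  "first_monomials d = (\<lambda>i. monomial (from_nat i :: 'n list)) ` {..<d}"

text \<open>Every polynomial involves only finitely many monomials, so it is a combination of \<open>B d\<close> for all large
\<open>d\<close>; the condition \<open>d \<ge> 1\<close> matches the index set \<open>d = 1, 2, \<dots>\<close> of the open sets.\<close>

lemma polynomial_combination_of_first_monomials:
  fixes p :: "complex ^ 'n \<Rightarrow> complex"
  assumes "complex_polynomial_function p"
    and "\<And>d f. f \<in> first_monomials d \<Longrightarrow> combination_on S (B d) f"
  shows "\<exists>d\<ge>1. combination_on S (B d) p"
proof -
  have "\<exists>d0. \<forall>d\<ge>d0. combination_on S (B d) p"
    using polynomial_monomial_sum[OF assms(1)]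
  proof induction
    case zero
    then show ?case
      unfolding combination_on_def by (intro exI[of _ 0] allI impI exI[of _ "\<lambda>_. 0"]) simp
  next
    case (step p c w)
    then obtain d0 where d0: "\<forall>d\<ge>d0. combination_on S (B d) p"
      by blast
    have "combination_on S (B d) (\<lambda>x. c * monomial w x + p x)"
      if "d \<ge> max d0 (Suc (to_nat w))" for d
    proof (rule combination_on_axpy)
      have "monomial w = monomial (from_nat (to_nat w) :: 'n list)"
        by simp
      then have "monomial w \<in> first_monomials d"
        using that unfolding first_monomials_def by (intro image_eqI[of _ _ "to_nat w"]) auto
      then show "combination_on S (B d) (monomial w)"
        by (rule assms(2))
    qed (use d0 that in auto)
    then show ?case
      by blast
  qed
  then obtain d0 where "\<forall>d\<ge>d0. combination_on S (B d) p"
    by blast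
  then show ?thesis
    by (intro exI[of _ "max 1 d0"]) simp
qed

section \<open>Coxeter mutation is birational\<close>

definition torus :: "(complex ^ 'n) set" where
  "torus = {a. \<forall>k. a $ k \<noteq> 0}"

context labelled_acyclic_quiver
begin

text \<open>Stated for \<open>\<mu> \<circ> v\<close> instead of \<open>\<mu>\<close>, so that it applies directly to the iterates of \<open>\<mu>\<close>.\<close>

lemma mutated_coord_fraction:
  assumes "\<And>j. fraction_on G (\<lambda>a. v a $ j)" "\<And>a. a \<in> G \<Longrightarrow> v a \<in> torus"
  shows "fraction_on G (\<lambda>a. mutated_coord (v a) k)"
proof (induction k rule: measure_induct_rule[of "\<lambda>k. card {..<k}"])
  case (less k)
  have "fraction_on G (\<lambda>a. mutated_coord (v a) (head Q e))"
    if "e \<in> {e. e \<in> arcs Q \<and> tail Q e = k}" for e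
  proof (rule less)
    have "head Q e < k"
      using that arrow_decreasing by blast
    then have "{..<head Q e} \<subset> {..<k}"
      by (auto intro: less_trans)
    then show "card {..<head Q e} < card {..<k}"
      by (simp add: psubset_card_mono)
  qed
  then have "fraction_on G (\<lambda>a. (1 + (\<Prod>e | e \<in> arcs Q \<and> head Q e = k. v a $ tail Q e) *
      (\<Prod>e | e \<in> arcs Q \<and> tail Q e = k. mutated_coord (v a) (head Q e))) / v a $ k)"
    using assms(2) by (intro fraction_on_divide fraction_on_add fraction_on_mult fraction_on_prod
        assms(1) fraction_on_polynomial[OF complex_polynomial_function.const]) (auto simp: torus_def)
  then show ?case
    by (subst mutated_coord.simps)
qed

lemma coxeter_mutation_fraction: "fraction_on torus (\<lambda>a. coxeter_mutation a $ k)"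
  using mutated_coord_fraction[of torus "\<lambda>a. a" k]
  by (simp add: coxeter_mutation_def fraction_on_polynomial complex_polynomial_function.coord)

text \<open>The exchange relation \<open>a\<^sub>k a\<^sub>k' = 1 + \<dots>\<close> is symmetric in \<open>a\<^sub>k\<close> and \<open>a\<^sub>k'\<close>, so it can be solved
for \<open>a\<^sub>k\<close> as well.  The other side involves, apart from the new coordinates, only \<open>a\<^sub>j\<close> with an arrow
\<open>j \<rightarrow> k\<close>; hence the recursion runs from the largest label down.\<close>

function unmutated_coord :: "(complex, 'n) vec \<Rightarrow> 'n \<Rightarrow> complex" where
  "unmutated_coord a k =
     (1 + (\<Prod>e | e \<in> arcs Q \<and> head Q e = k. unmutated_coord a (tail Q e)) *
          (\<Prod>e | e \<in> arcs Q \<and> tail Q e = k. a $ head Q e)) / a $ k"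
  by pat_completeness auto
termination
proof (relation "Wellfounded.measure (\<lambda>(a, k). card {k<..})")
  fix a :: "(complex, 'n) vec" and k :: 'n and e
  assume "e \<in> {e. e \<in> arcs Q \<and> head Q e = k}"
  then have "k < tail Q e"
    using arrow_decreasing by blast
  then have "{tail Q e<..} \<subset> {k<..}"
    by (auto intro: less_trans)
  then show "((a, tail Q e), (a, k)) \<in> Wellfounded.measure (\<lambda>(a, k). card {k<..})"
    by (simp add: psubset_card_mono)
qed simp

declare unmutated_coord.simps [simp del]

definition inverse_mutation :: "(complex, 'n) vec \<Rightarrow> (complex, 'n) vec" where
  "inverse_mutation a = (\<chi> k. unmutated_coord a k)"

lemma tail_induct:
  assumes "\<And>k. (\<And>e. e \<in> arcs Q \<Longrightarrow> head Q e = k \<Longrightarrow> P (tail Q e)) \<Longrightarrow> P k"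
  shows "P k"
proof (induction k rule: measure_induct_rule[of "\<lambda>k. card {k<..}"])
  case (less k)
  show ?case
  proof (rule assms)
    fix e assume "e \<in> arcs Q" "head Q e = k"
    then have "{tail Q e<..} \<subset> {k<..}"
      using arrow_decreasing[of e] by (auto intro: less_trans)
    then show "P (tail Q e)"
      by (intro less) (simp add: psubset_card_mono)
  qed
qed

lemma inverse_mutation_fraction: "fraction_on torus (\<lambda>a. inverse_mutation a $ k)"
proof (induction k rule: tail_induct)
  case (1 k)
  then have "fraction_on torus (\<lambda>a. (1 + (\<Prod>e | e \<in> arcs Q \<and> head Q e = k. unmutated_coord a (tail Q e)) *
      (\<Prod>e | e \<in> arcs Q \<and> tail Q e = k. a $ head Q e)) / a $ k)"
    by (intro fraction_on_divide fraction_on_add fraction_on_mult fraction_on_prod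
        fraction_on_polynomial[OF complex_polynomial_function.const]
        fraction_on_polynomial[OF complex_polynomial_function.coord])
      (auto simp: torus_def inverse_mutation_def)
  then show ?case
    unfolding inverse_mutation_def vec_lambda_beta by (subst unmutated_coord.simps)
qed

lemma inverse_mutation:
  assumes "a \<in> torus" "coxeter_mutation a \<in> torus"
  shows "inverse_mutation (coxeter_mutation a) = a"
proof -
  have "unmutated_coord (coxeter_mutation a) k = a $ k" for k
  proof (induction k rule: tail_induct)
    case (1 k)
    let ?in = "\<Prod>e | e \<in> arcs Q \<and> head Q e = k. a $ tail Q e"
    let ?out = "\<Prod>e | e \<in> arcs Q \<and> tail Q e = k. mutated_coord a (head Q e)"
    have mk: "1 + ?in * ?out = mutated_coord a k * a $ k"
      using assms(1) by (subst mutated_coord.simps) (simp add: torus_def)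
    moreover have "mutated_coord a k \<noteq> 0"
      using assms(2) by (simp add: torus_def coxeter_mutation_def)
    moreover have "unmutated_coord (coxeter_mutation a) k = (1 + ?in * ?out) / mutated_coord a k"
      using 1 by (subst unmutated_coord.simps) (simp add: coxeter_mutation_def)
    ultimately show ?case
      unfolding mk by simp
  qed
  then show ?thesis
    by (simp add: inverse_mutation_def vec_eq_iff)
qed

section \<open>Orbits and their closures\<close>

lemma vanishes_on_frieze_variety:
  assumes "complex_polynomial_function p" "\<forall>x\<in>coxeter_orbit a. p x = 0"
  shows "\<forall>x\<in>frieze_variety a. p x = 0"
  unfolding frieze_variety_def
proof
  fix x assume "x \<in> zariski closure_of coxeter_orbit a"
  then have "complex_polynomial_function p \<longrightarrow> (\<forall>x\<in>coxeter_orbit a. p x = 0) \<longrightarrow> p x = 0"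
    unfolding zariski_closure_iff by (rule spec)
  then show "p x = 0"
    using assms by simp
qed

lemma orbit_mutation: "coxeter_orbit (coxeter_mutation a) = coxeter_mutation ` coxeter_orbit a"
proof -
  have "coxeter_orbit x = range (\<lambda>t. (coxeter_mutation ^^ t) x)" for x
    by (auto simp: coxeter_orbit_def)
  then show ?thesis
    by (simp add: image_image funpow_swap1)
qed

lemma orbit_insert: "coxeter_orbit a = insert a (coxeter_orbit (coxeter_mutation a))"
proof -
  have "\<exists>t. x = (coxeter_mutation ^^ t) (coxeter_mutation a)"
    if "x = (coxeter_mutation ^^ t) a" "x \<noteq> a" for x t
    using that by (cases t) (auto simp: funpow_swap1)
  moreover have "\<exists>s. (coxeter_mutation ^^ t) (coxeter_mutation a) = (coxeter_mutation ^^ s) a" for t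
    by (intro exI[of _ "Suc t"]) (simp add: funpow_swap1)
  moreover have "\<exists>s. a = (coxeter_mutation ^^ s) a"
    by (intro exI[of _ 0]) simp
  ultimately show ?thesis
    unfolding coxeter_orbit_def by blast
qed

lemma generic_iff_orbit: "generic_specialization a \<longleftrightarrow> coxeter_orbit a \<subseteq> torus"
  unfolding generic_specialization_def coxeter_orbit_def torus_def by auto

lemma generic_mutation:
  "generic_specialization a \<Longrightarrow> generic_specialization (coxeter_mutation a)"
  using orbit_insert[of a] by (auto simp: generic_iff_orbit)

lemma generic_iterate:
  "generic_specialization a \<Longrightarrow> generic_specialization ((coxeter_mutation ^^ t) a)"
  by (induction t) (auto intro: generic_mutation)

lemma orbit_subset_frieze_variety: "coxeter_orbit a \<subseteq> frieze_variety a"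
  unfolding frieze_variety_def by (intro closure_of_subset) simp

lemma mem_frieze_variety: "a \<in> frieze_variety a"
  by (rule subsetD[OF orbit_subset_frieze_variety]) (subst orbit_insert, simp)

lemma frieze_variety_least:
  "coxeter_orbit a \<subseteq> frieze_variety b \<Longrightarrow> frieze_variety a \<subseteq> frieze_variety b"
  unfolding frieze_variety_def by (intro closure_of_minimal) auto

lemma mutation_mem_frieze_variety:
  assumes "a \<in> torus" "generic_specialization b" "a \<in> frieze_variety b"
  shows "coxeter_mutation a \<in> frieze_variety (coxeter_mutation b)"
  using fraction_map_closure[OF coxeter_mutation_fraction, of "coxeter_orbit b" a] assms
  by (simp add: frieze_variety_def orbit_mutation generic_iff_orbit)

text \<open>The inverse mutation maps the orbit of \<open>\<mu>(b)\<close> onto the orbit of \<open>b\<close>, and it is continuous on the torus.\<close>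

lemma inverse_mutation_mem_frieze_variety:
  assumes "generic_specialization a" "generic_specialization b"
    and "coxeter_mutation a \<in> frieze_variety (coxeter_mutation b)"
  shows "a \<in> frieze_variety b"
proof -
  have inv: "inverse_mutation (coxeter_mutation x) = x"
    if "generic_specialization x" for x
    using that orbit_insert[of x] orbit_insert[of "coxeter_mutation x"]
    by (intro inverse_mutation) (auto simp: generic_iff_orbit)
  have "generic_specialization x" if "x \<in> coxeter_orbit b" for x
    using that generic_iterate[OF assms(2)] unfolding coxeter_orbit_def by blast
  then have "inverse_mutation ` coxeter_orbit (coxeter_mutation b) = coxeter_orbit b"
    unfolding orbit_mutation image_image using inv by simp
  moreover have "coxeter_orbit (coxeter_mutation b) \<subseteq> torus" "coxeter_mutation a \<in> torus"
    using generic_mutation[OF assms(2)] generic_mutation[OF assms(1)]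
      orbit_insert[of "coxeter_mutation a"] by (auto simp: generic_iff_orbit)
  ultimately show ?thesis
    using fraction_map_closure[OF inverse_mutation_fraction, of "coxeter_orbit (coxeter_mutation b)"
        "coxeter_mutation a"] assms(3) inv[OF assms(1)]
    by (simp add: frieze_variety_def)
qed

lemma frieze_variety_mutation_subset: "frieze_variety (coxeter_mutation a) \<subseteq> frieze_variety a"
  using orbit_subset_frieze_variety[of a] orbit_insert[of a]
  by (intro frieze_variety_least) blast

lemma frieze_variety_mutation_eqI:
  assumes "a \<in> frieze_variety (coxeter_mutation a)"
  shows "frieze_variety (coxeter_mutation a) = frieze_variety a"
proof (rule antisym[OF frieze_variety_mutation_subset frieze_variety_least])
  show "coxeter_orbit a \<subseteq> frieze_variety (coxeter_mutation a)"
    using assms orbit_subset_frieze_variety[of "coxeter_mutation a"]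
    by (subst orbit_insert) simp
qed

text \<open>The descending chain condition yields a time \<open>t\<close> at which \<open>b\<^sub>t\<close> is in the closure of its own future orbit;
the inverse mutation carries this property back to time \<open>0\<close>.\<close>

lemma generic_point_recurs:
  assumes "generic_specialization b"
  shows "b \<in> frieze_variety (coxeter_mutation b)"
proof -
  define X where "X t = frieze_variety ((coxeter_mutation ^^ t) b)" for t
  have alg: "algebraic_set (X t)" for t
    using closedin_closure_of[of zariski "coxeter_orbit ((coxeter_mutation ^^ t) b)"]
    unfolding X_def frieze_variety_def closedin_zariski .
  have "\<not> (\<forall>t. (X (Suc t), X t) \<in> {(Z', Z). algebraic_set Z' \<and> algebraic_set Z \<and> Z' \<subset> Z})"
    using wf_algebraic_sets unfolding wf_iff_no_infinite_down_chain by blast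
  then obtain t where "\<not> X (Suc t) \<subset> X t"
    using alg by auto
  moreover have "X (Suc t) \<subseteq> X t"
    using frieze_variety_mutation_subset[of "(coxeter_mutation ^^ t) b"] by (simp add: X_def)
  ultimately have "X t \<subseteq> X (Suc t)"
    by blast
  moreover have "(coxeter_mutation ^^ t) b \<in> X t"
    unfolding X_def by (rule mem_frieze_variety)
  ultimately have "(coxeter_mutation ^^ t) b \<in> X (Suc t)"
    by (rule subsetD)
  then have "(coxeter_mutation ^^ t) b \<in> frieze_variety (coxeter_mutation ((coxeter_mutation ^^ t) b))"
    by (simp add: X_def)
  then show ?thesis
  proof (induction t)
    case (Suc t)
    have "generic_specialization ((coxeter_mutation ^^ t) b)"
      "generic_specialization (coxeter_mutation ((coxeter_mutation ^^ t) b))"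
      using generic_iterate[OF assms, of t] generic_iterate[OF assms, of "Suc t"] by simp_all
    then show ?case
      using Suc.prems by (intro Suc.IH) (rule inverse_mutation_mem_frieze_variety, simp_all)
  qed simp
qed

lemma frieze_variety_iterate:
  assumes "generic_specialization b"
  shows "frieze_variety ((coxeter_mutation ^^ t) b) = frieze_variety b"
proof (induction t)
  case (Suc t)
  then show ?case
    using frieze_variety_mutation_eqI[OF generic_point_recurs[OF generic_iterate[OF assms]], of t]
    by simp
qed simp

lemma frieze_variety_subset:
  assumes "generic_specialization a" "generic_specialization b" "a \<in> frieze_variety b"
  shows "frieze_variety a \<subseteq> frieze_variety b"
proof (rule frieze_variety_least)
  have "(coxeter_mutation ^^ t) a \<in> frieze_variety b" for t
  proof (induction t)
    case (Suc t)
    moreover have "(coxeter_mutation ^^ t) a \<in> torus"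
      using generic_iterate[OF assms(1), of t] orbit_insert[of "(coxeter_mutation ^^ t) a"] by (auto simp: generic_iff_orbit)
    ultimately show ?case
      using mutation_mem_frieze_variety[OF _ assms(2)] frieze_variety_mutation_subset[of b] by auto
  qed (simp add: assms(3))
  then show "coxeter_orbit a \<subseteq> frieze_variety b"
    unfolding coxeter_orbit_def by blast
qed

section \<open>Genericity up to a finite time\<close>

text \<open>Genericity is an infinite conjunction of open conditions; these are its finite parts.\<close>

definition generic_upto :: "nat \<Rightarrow> ((complex, 'n) vec) set" where
  "generic_upto d = {a. \<forall>s\<le>d. (coxeter_mutation ^^ s) a \<in> torus}"

text \<open>Computing the \<open>s\<close>-th iterate divides only by coordinates of earlier iterates, so one step
beyond \<open>d\<close> is still controlled.  This extra step makes \<open>generic_upto (Suc d)\<close> open.\<close>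

lemma iterate_fraction:
  assumes "s \<le> Suc d"
  shows "fraction_on (generic_upto d) (\<lambda>a. (coxeter_mutation ^^ s) a $ k)"
  using assms
proof (induction s arbitrary: k)
  case 0
  then show ?case
    by (simp add: fraction_on_polynomial complex_polynomial_function.coord)
next
  case (Suc s)
  then show ?case
    using mutated_coord_fraction[of "generic_upto d" "coxeter_mutation ^^ s" k]
    by (simp add: coxeter_mutation_def[of "(coxeter_mutation ^^ s) _"] generic_upto_def)
qed

lemma openin_fraction_map_torus:
  fixes v :: "(complex, 'n) vec \<Rightarrow> (complex, 'n) vec"
  assumes "\<And>k. fraction_on G (\<lambda>a. v a $ k)" "openin zariski G"
  shows "openin zariski {a \<in> G. v a \<in> torus}"
  using openin_fraction_nonzero[OF fraction_on_prod[of UNIV G "\<lambda>k a. v a $ k"] assms(2)] assms(1)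
  by (simp add: torus_def)

lemma openin_generic_upto: "openin zariski (generic_upto d)"
proof (induction d)
  case 0
  have "openin zariski {a \<in> UNIV. a \<in> (torus :: ((complex, 'n) vec) set)}"
    using openin_topspace[of zariski] by (intro openin_fraction_map_torus)
      (auto intro: fraction_on_polynomial complex_polynomial_function.coord)
  then show ?case
    by (simp add: generic_upto_def)
next
  case (Suc d)
  have "generic_upto (Suc d) = {a \<in> generic_upto d. (coxeter_mutation ^^ Suc d) a \<in> torus}"
    unfolding generic_upto_def by (auto simp: le_Suc_eq)
  then show ?case
    using openin_fraction_map_torus[OF iterate_fraction[OF order_refl] Suc] by simp
qed

lemma generic_in_generic_upto: "generic_specialization a \<Longrightarrow> a \<in> generic_upto d"
  by (auto simp: generic_iff_orbit generic_upto_def coxeter_orbit_def)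

lemma generic_upto_antimono: "d \<le> d' \<Longrightarrow> generic_upto d' \<subseteq> generic_upto d"
  unfolding generic_upto_def by auto

text \<open>The component \<open>Y\<close> contains some \<open>b\<^sub>t\<close>.  Since \<open>X(Q,b\<^sub>t) = X(Q,b)\<close>, the functions in \<open>B\<close> are also
independent on the orbit of \<open>b\<^sub>t\<close>, so the open condition of \<open>independence_open\<close> holds at that point.\<close>

lemma dense_open_independent:
  assumes b: "generic_specialization b"
    and Y: "Y \<in> irreducible_components zariski (frieze_variety b)"
    and B: "finite B" "\<And>g. g \<in> B \<Longrightarrow> complex_polynomial_function g"
      "independent_on (coxeter_orbit b) B"
  shows "\<exists>U. dense_open_in zariski Y U \<and>
    (\<forall>a\<in>U. a \<in> generic_upto d \<and> independent_on (coxeter_orbit a) B)"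
proof -
  obtain t where t: "(coxeter_mutation ^^ t) b \<in> Y"
    using irreducible_component_meets_dense_set[of Y "coxeter_orbit b"] Y
    unfolding frieze_variety_def coxeter_orbit_def by blast
  let ?bt = "(coxeter_mutation ^^ t) b"
  let ?h = "\<lambda>g s a. g ((coxeter_mutation ^^ s) a)"
  \<comment> \<open>The elimination may use arbitrarily late times, and later iterates are fractions on smaller
    sets only, so the algebra of coefficient functions is a union over all times.\<close>
  define R where "R = {h. \<exists>s. fraction_on (generic_upto s) h}"
  have common: "\<exists>s. fraction_on (generic_upto s) f \<and> fraction_on (generic_upto s) g"
    if "f \<in> R" "g \<in> R" for f g
  proof -
    obtain s s' where "fraction_on (generic_upto s) f" "fraction_on (generic_upto s') g"
      using \<open>f \<in> R\<close> \<open>g \<in> R\<close> unfolding R_def by blast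
    then show ?thesis
      by (intro exI[of _ "max s s'"] conjI) (auto elim!: fraction_on_subset intro!: generic_upto_antimono)
  qed
  have "\<exists>D\<in>R. D ?bt \<noteq> 0 \<and> (\<forall>a. D a \<noteq> 0 \<longrightarrow>
      (\<forall>c. (\<forall>s. (\<Sum>g\<in>B. c g * ?h g s a) = 0) \<longrightarrow> (\<forall>g\<in>B. c g = 0)))"
  proof (rule independence_open)
    show "(\<lambda>x. f x * g x) \<in> R" "(\<lambda>x. f x - g x) \<in> R" if "f \<in> R" "g \<in> R" for f g
      using common[OF that] unfolding R_def by (auto intro: fraction_on_mult fraction_on_diff)
    show "(\<lambda>x. 1) \<in> R"
      unfolding R_def by (auto intro: fraction_on_polynomial complex_polynomial_function.const)
    show "?h g s \<in> R" if "g \<in> B" for g s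
      unfolding R_def using fraction_on_compose[OF B(2)[OF that] iterate_fraction[of s s]] by auto
    show "\<forall>g\<in>B. c g = 0" if c: "\<forall>s. (\<Sum>g\<in>B. c g * ?h g s ?bt) = 0" for c
    proof -
      have "complex_polynomial_function (\<lambda>x. \<Sum>g\<in>B. c g * g x)"
        using B(2) by (rule complex_polynomial_function_combination)
      moreover have "\<forall>x\<in>coxeter_orbit ?bt. (\<Sum>g\<in>B. c g * g x) = 0"
        using c unfolding coxeter_orbit_def by blast
      ultimately have "\<forall>x\<in>frieze_variety ?bt. (\<Sum>g\<in>B. c g * g x) = 0"
        by (rule vanishes_on_frieze_variety)
      then have "\<forall>x\<in>coxeter_orbit b. (\<Sum>g\<in>B. c g * g x) = 0"
        using orbit_subset_frieze_variety unfolding frieze_variety_iterate[OF b] by blast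
      then show ?thesis
        using B(3) unfolding independent_on_def by blast
    qed
  qed (rule B(1))
  then obtain D where D: "D \<in> R" "D ?bt \<noteq> 0"
    and indep: "\<And>a c. D a \<noteq> 0 \<Longrightarrow> \<forall>s. (\<Sum>g\<in>B. c g * ?h g s a) = 0 \<Longrightarrow> \<forall>g\<in>B. c g = 0"
    by blast
  obtain s where s: "fraction_on (generic_upto s) D"
    using D(1) unfolding R_def by blast
  let ?W = "{a \<in> generic_upto (max s d). D a \<noteq> 0}"
  have "openin zariski ?W"
    by (intro openin_fraction_nonzero openin_generic_upto fraction_on_subset[OF s]
        generic_upto_antimono) simp
  moreover have "?bt \<in> Y \<inter> ?W"
    using t D(2) generic_in_generic_upto[OF generic_iterate[OF b]] by simp
  ultimately have "dense_open_in zariski Y (Y \<inter> ?W)"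
    using Y by (intro dense_open_in_irreducible) (auto simp: irreducible_components_def)
  moreover have "independent_on (coxeter_orbit a) B" if "D a \<noteq> 0" for a
    unfolding independent_on_def
  proof (intro allI impI)
    fix c assume "\<forall>x\<in>coxeter_orbit a. (\<Sum>g\<in>B. c g * g x) = 0"
    then have "\<forall>s. (\<Sum>g\<in>B. c g * ?h g s a) = 0"
      unfolding coxeter_orbit_def by blast
    then show "\<forall>g\<in>B. c g = 0"
      by (rule indep[OF that])
  qed
  moreover have "generic_upto (max s d) \<subseteq> generic_upto d"
    by (rule generic_upto_antimono) simp
  ultimately show ?thesis
    by blast
qed

text \<open>If \<open>p\<close> vanishes on the orbit of \<open>a\<close>, write it on \<open>X(Q,b)\<close> as a combination of some \<open>B d\<close>.  The orbit of
\<open>a\<close> lies in \<open>X(Q,b)\<close>, so this combination vanishes there and independence makes it trivial;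
therefore \<open>p\<close> vanishes on \<open>X(Q,b)\<close>.\<close>

lemma frieze_variety_eq_of_independent:
  assumes a: "generic_specialization a" and b: "generic_specialization b"
    and ab: "a \<in> frieze_variety b"
    and B: "\<And>d. B d \<subseteq> first_monomials d"
      "\<And>d f. f \<in> first_monomials d \<Longrightarrow> combination_on (coxeter_orbit b) (B d) f"
    and indep: "\<And>d. d \<ge> 1 \<Longrightarrow> independent_on (coxeter_orbit a) (B d)"
  shows "frieze_variety a = frieze_variety b"
proof (rule antisym[OF frieze_variety_subset[OF a b ab] frieze_variety_least])
  have poly: "complex_polynomial_function g" if "g \<in> B d" for g d
    using subsetD[OF B(1) that] unfolding first_monomials_def by (auto intro: monomial_polynomial)
  show "coxeter_orbit b \<subseteq> frieze_variety a"
    unfolding frieze_variety_def subset_iff zariski_closure_iff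
  proof (intro allI impI)
    fix x p assume x: "x \<in> coxeter_orbit b" and p: "complex_polynomial_function p"
      and p0: "\<forall>x\<in>coxeter_orbit a. p x = 0"
    obtain d where d: "d \<ge> 1" "combination_on (coxeter_orbit b) (B d) p"
      using polynomial_combination_of_first_monomials[of p "coxeter_orbit b" B, OF p B(2)] by blast
    obtain c where c: "\<forall>x\<in>coxeter_orbit b. p x = (\<Sum>g\<in>B d. c g * g x)"
      using d(2) unfolding combination_on_def by blast
    have "complex_polynomial_function (\<lambda>x. p x - (\<Sum>g\<in>B d. c g * g x))"
      using p poly by (intro complex_polynomial_function_diff complex_polynomial_function_combination)
    moreover have "\<forall>x\<in>coxeter_orbit b. p x - (\<Sum>g\<in>B d. c g * g x) = 0"
      using c by simp
    ultimately have "\<forall>x\<in>frieze_variety b. p x - (\<Sum>g\<in>B d. c g * g x) = 0"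
      by (rule vanishes_on_frieze_variety)
    moreover have "coxeter_orbit a \<subseteq> frieze_variety b"
      using orbit_subset_frieze_variety[of a] frieze_variety_subset[OF a b ab] by blast
    ultimately have "p x - (\<Sum>g\<in>B d. c g * g x) = 0" if "x \<in> coxeter_orbit a" for x
      using that by blast
    then have "\<forall>x\<in>coxeter_orbit a. (\<Sum>g\<in>B d. c g * g x) = 0"
      using p0 by simp
    then have "\<forall>g\<in>B d. c g = 0"
      using indep[OF d(1)] unfolding independent_on_def by blast
    then show "p x = 0"
      using c x by simp
  qed
qed

end

theorem theorem3p5:
  fixes Q :: "('n :: {finite, linorder}, 'e) pre_digraph"
    and b :: "(complex, 'n) vec"
  assumes "labelled_acyclic_quiver Q"
    and "labelled_acyclic_quiver.generic_specialization Q b"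
  shows "\<exists>U :: ((complex, 'n) vec) set \<Rightarrow> nat \<Rightarrow> ((complex, 'n) vec) set.
     (\<forall>Y \<in> irreducible_components zariski (labelled_acyclic_quiver.frieze_variety Q b).
        \<forall>d\<ge>1. dense_open_in zariski Y (U Y d)) \<and>
     (\<forall>a \<in> (\<Union>Y \<in> irreducible_components zariski (labelled_acyclic_quiver.frieze_variety Q b).
              \<Inter>d\<in>{1..}. U Y d).
        labelled_acyclic_quiver.generic_specialization Q a \<and>
        labelled_acyclic_quiver.frieze_variety Q a = labelled_acyclic_quiver.frieze_variety Q b)"
proof -
  interpret labelled_acyclic_quiver Q
    by (rule assms(1))
  let ?comps = "irreducible_components zariski (frieze_variety b)"
  have fin: "finite (first_monomials d :: ((complex, 'n) vec \<Rightarrow> complex) set)" for d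
    by (simp add: first_monomials_def)
  have "\<forall>d. \<exists>B\<subseteq>first_monomials d. independent_on (coxeter_orbit b) B \<and>
      (\<forall>f\<in>first_monomials d. combination_on (coxeter_orbit b) B f)"
    using exists_basis_on[OF fin] by blast
  then obtain B where B: "\<And>d. B d \<subseteq> first_monomials d"
    "\<And>d. independent_on (coxeter_orbit b) (B d)"
    "\<And>d f. f \<in> first_monomials d \<Longrightarrow> combination_on (coxeter_orbit b) (B d) f"
    by metis
  have "\<exists>U. dense_open_in zariski Y U \<and>
      (\<forall>a\<in>U. a \<in> generic_upto d \<and> independent_on (coxeter_orbit a) (B d))"
    if "Y \<in> ?comps" for Y d
  proof (rule dense_open_independent[OF assms(2) that _ _ B(2)])
    show "finite (B d)"
      using finite_subset[OF B(1) fin] .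
    show "complex_polynomial_function g" if "g \<in> B d" for g
      using subsetD[OF B(1) that] unfolding first_monomials_def by (auto intro: monomial_polynomial)
  qed
  then obtain U where U: "\<And>Y d. Y \<in> ?comps \<Longrightarrow> dense_open_in zariski Y (U Y d)"
    "\<And>Y d a. Y \<in> ?comps \<Longrightarrow> a \<in> U Y d \<Longrightarrow> a \<in> generic_upto d"
    "\<And>Y d a. Y \<in> ?comps \<Longrightarrow> a \<in> U Y d \<Longrightarrow> independent_on (coxeter_orbit a) (B d)"
    by metis
  show ?thesis
  proof (intro exI[of _ U] conjI ballI allI impI)
    fix Y :: "((complex, 'n) vec) set" and d :: nat
    assume "Y \<in> ?comps"
    then show "dense_open_in zariski Y (U Y d)"
      by (rule U(1))
  next
    fix a assume "a \<in> (\<Union>Y \<in> ?comps. \<Inter>d\<in>{1..}. U Y d)"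
    then obtain Y where Y: "Y \<in> ?comps" and a: "\<And>d. d \<ge> 1 \<Longrightarrow> a \<in> U Y d"
      by auto
    have "(coxeter_mutation ^^ s) a \<in> torus" for s
      using U(2)[OF Y a, of "Suc s"] unfolding generic_upto_def by simp
    then show generic: "generic_specialization a"
      unfolding generic_iff_orbit coxeter_orbit_def by blast
    have "U Y 1 \<subseteq> topspace (subtopology zariski Y)"
      using U(1)[OF Y, of 1] openin_subset unfolding dense_open_in_def by blast
    then have "a \<in> frieze_variety b"
      using Y a[of 1] unfolding irreducible_components_def by auto
    then show "frieze_variety a = frieze_variety b"
      using U(3)[OF Y a]
      by (intro frieze_variety_eq_of_independent[OF generic assms(2) _ B(1,3)])
  qed
qed

end
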